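(* There is a universal constant $c>0$ such that the following holds. Let $K$ and $L$ be convex bodies in $\mathbb{R}^d$ with $B_2^d\subseteq K\subseteq (1+1/d^2)B_2^d$. Assume that $K$ is in John's position in $L$, and that the vectors $u_i$ and $v_i$, $i\in[m]$, satisfy the conditions of the definition of John's position (given in the context). Then for any $\varepsilon\in(0,1)$ and any positive integer $$k\geq\frac{c\,d\ln d}{\varepsilon^2},$$ there is a multiset $\sigma\subset[m]$ of size $k$ such that $$\left\|\frac{d}{k}\sum_{i\in\sigma}u_i\otimes v_i-I\right\|\leq\varepsilon$$ and $$\frac{1}{k}\left\|\sum_{i\in\sigma}u_i\right\|\leq\frac{\varepsilon}{\sqrt d}\quad\text{and}\quad\frac{1}{k}\left\|\sum_{i\in\sigma}v_i\right\|\leq\frac{\varepsilon}{\sqrt d}.$$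
   Context: $[m]=\{1,\ldots,m\}$. $B_2^d$ is the Euclidean unit ball of $\mathbb{R}^d$ centered at the origin, $I$ is the identity operator on $\mathbb{R}^d$. For $u,v\in\mathbb{R}^d$, $u\otimes v$ is the linear operator $(u\otimes v)x=\langle u,x\rangle v$. For operators $\|\cdot\|$ is the operator norm (induced by the Euclidean norm); for vectors it is the Euclidean norm. A multiset $\sigma\subset[m]$ may contain elements repeatedly; its size and sums over it are counted with multiplicity. The polar of a convex body $K$ is $K^\circ=\{x: \langle x,y\rangle\leq 1\text{ for every }y\in K\}$, and $\mathrm{bd}$ denotes the boundary. Definition (John's position). Let $K$ and $L$ be convex bodies in $\mathbb{R}^d$. $K$ is in John's position in $L$ if $K\subseteq L$ and for some scalars $\alpha_1,\ldots,\alpha_m>0$ with $\sum_{i=1}^m\alpha_i=1$ we have $$\frac1d I=\sum_{i=1}^m\alpha_i\,u_i\otimes v_i\quad\text{and}\quad 0=\sum_{i=1}^m\alpha_iu_i=\sum_{i=1}^m\alpha_iv_i,$$ where $u_1,\ldots,u_m\in\mathrm{bd}(L)\cap\mathrm{bd}(K)$, $v_1,\ldots,v_m\in\mathrm{bd}(L^\circ)\cap\mathrm{bd}(K^\circ)$ with $\langle u_i,v_i\rangle=1$ for all $i\in[m]$.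
   Formalization: The dimension is assumed to be d ≥ 2; for d = 1 the claim fails, since ln d = 0 admits k = 1, and for K = L = [-1,1] with u_i = v_i = ±1 a single vector has norm 1 > ε. *)

theory Defs
  imports
    "HOL-Analysis.Analysis"
    "HOL-Library.Function_Algebras"
    "HOL-Library.Multiset"
begin

text \<open>
  The dimension \<open>d\<close> is quantified inside the scope of the universal constant, so it has to be a
  natural number and not a type. The space of dimension \<open>d\<close> is the library's
  \<^const>\<open>Euclidean_space\<close>, whose points are the functions of type \<^typ>\<open>nat \<Rightarrow> real\<close> that vanish
  from index \<open>d\<close> on. With pointwise scalar multiplication, functions form a real vector space, so
  that \<^const>\<open>convex\<close> applies and both vectors and operators can be added and scaled directly.
\<close>

instantiation "fun" :: (type, real_vector) real_vector
begin

definition scaleR_fun :: "real \<Rightarrow> ('a \<Rightarrow> 'b) \<Rightarrow> 'a \<Rightarrow> 'b"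
  where "scaleR_fun r f = (\<lambda>x. r *\<^sub>R f x)"

instance
  by standard (simp_all add: scaleR_fun_def fun_eq_iff scaleR_add_right scaleR_add_left)

end

abbreviation eucl :: "nat \<Rightarrow> (nat \<Rightarrow> real) set"
  where "eucl d \<equiv> topspace (Euclidean_space d)"

abbreviation bd :: "nat \<Rightarrow> (nat \<Rightarrow> real) set \<Rightarrow> (nat \<Rightarrow> real) set"
  where "bd d K \<equiv> Euclidean_space d frontier_of K"

definition ip :: "nat \<Rightarrow> (nat \<Rightarrow> real) \<Rightarrow> (nat \<Rightarrow> real) \<Rightarrow> real"
  where "ip d x y = (\<Sum>i<d. x i * y i)"

definition enorm :: "nat \<Rightarrow> (nat \<Rightarrow> real) \<Rightarrow> real"
  where "enorm d x = L2_set x {..<d}"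

definition unit_ball :: "nat \<Rightarrow> (nat \<Rightarrow> real) set"
  where "unit_ball d = {x \<in> eucl d. enorm d x \<le> 1}"

definition convex_body :: "nat \<Rightarrow> (nat \<Rightarrow> real) set \<Rightarrow> bool"
  where "convex_body d K \<longleftrightarrow>
    compactin (Euclidean_space d) K \<and> convex K \<and> Euclidean_space d interior_of K \<noteq> {}"

definition polar_body :: "nat \<Rightarrow> (nat \<Rightarrow> real) set \<Rightarrow> (nat \<Rightarrow> real) set"
  where "polar_body d K = {x \<in> eucl d. \<forall>y\<in>K. ip d x y \<le> 1}"

definition tensor :: "nat \<Rightarrow> (nat \<Rightarrow> real) \<Rightarrow> (nat \<Rightarrow> real) \<Rightarrow> (nat \<Rightarrow> real) \<Rightarrow> (nat \<Rightarrow> real)"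
  where "tensor d u v x = ip d u x *\<^sub>R v"

text \<open>
  The same quotient as in the library's \<^const>\<open>onorm\<close>, with the supremum restricted to the
  \<open>d\<close>-dimensional space; the point \<open>0\<close> contributes the value \<open>0\<close>.
\<close>

definition op_norm :: "nat \<Rightarrow> ((nat \<Rightarrow> real) \<Rightarrow> (nat \<Rightarrow> real)) \<Rightarrow> real"
  where "op_norm d T = (SUP x\<in>eucl d. enorm d (T x) / enorm d x)"

text \<open>
  Operators are total functions on \<^typ>\<open>nat \<Rightarrow> real\<close>, hence the decomposition of the identity is
  required only on the \<open>d\<close>-dimensional space.
\<close>

definition john_decomposition ::
  "nat \<Rightarrow> (nat \<Rightarrow> real) set \<Rightarrow> (nat \<Rightarrow> real) set \<Rightarrow> nat \<Rightarrow>
    (nat \<Rightarrow> real) \<Rightarrow> (nat \<Rightarrow> nat \<Rightarrow> real) \<Rightarrow> (nat \<Rightarrow> nat \<Rightarrow> real) \<Rightarrow> bool"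
  where "john_decomposition d K L m \<alpha> u v \<longleftrightarrow>
    (\<forall>i\<in>{1..m}. \<alpha> i > 0) \<and> (\<Sum>i=1..m. \<alpha> i) = 1 \<and>
    (\<forall>x\<in>eucl d. (1 / real d) *\<^sub>R x = (\<Sum>i=1..m. \<alpha> i *\<^sub>R tensor d (u i) (v i)) x) \<and>
    (\<Sum>i=1..m. \<alpha> i *\<^sub>R u i) = 0 \<and> (\<Sum>i=1..m. \<alpha> i *\<^sub>R v i) = 0 \<and>
    (\<forall>i\<in>{1..m}. u i \<in> bd d L \<inter> bd d K) \<and>
    (\<forall>i\<in>{1..m}. v i \<in> bd d (polar_body d L) \<inter> bd d (polar_body d K)) \<and>
    (\<forall>i\<in>{1..m}. ip d (u i) (v i) = 1)"

definition in_john_position :: "nat \<Rightarrow> (nat \<Rightarrow> real) set \<Rightarrow> (nat \<Rightarrow> real) set \<Rightarrow> bool"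
  where "in_john_position d K L \<longleftrightarrow> K \<subseteq> L \<and> (\<exists>m \<alpha> u v. john_decomposition d K L m \<alpha> u v)"

end

theory Submission
  imports Defs
begin

text \<open>
  The vectors \<open>w = v - u\<close> have length \<open>O(1/d)\<close>, since \<open>|u| \<le> 1 + 1/d\<^sup>2\<close>, \<open>|v| \<le> 1\<close> and
  \<open>\<langle>u, v\<rangle> = 1\<close>. The multiset is sampled independently according to the weights \<open>\<alpha>\<close>. The sums of
  the \<open>u\<close>, of the \<open>v\<close> and of the operators \<open>u \<otimes> w\<close> are controlled by their second moments. For
  the centred sum \<open>Y\<close> of the operators \<open>u \<otimes> u\<close> one bounds the expected trace of \<open>Y^(2p)\<close> with
  \<open>p \<approx> ln d\<close>: writing one factor \<open>Y\<close> as the sum of its terms and resampling one coordinate at a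
  time (an exchangeable pair) bounds the moment of order \<open>2q\<close> by a multiple of the moment of
  order \<open>2q - 2\<close>. No spectral theorem is needed, because all trace inequalities involved follow
  from the Cauchy-Schwarz inequality for the Hilbert-Schmidt form.
\<close>

section \<open>Powers of commuting self-adjoint operators\<close>

text \<open>Induction on the right endpoint. Convexity at the last interior index puts that term
  below the longer chord, and this is substituted into the induction hypothesis for the shorter
  chord.\<close>

lemma discrete_convex_chord:
  fixes f :: "nat \<Rightarrow> real"
  assumes convex: "\<And>a. a + 1 < n \<Longrightarrow> 2 * f (a + 1) \<le> f a + f (a + 2)" and "a \<le> n"
  shows "real n * f a \<le> (real n - real a) * f 0 + real a * f n"
  using assms
proof (induction n arbitrary: a)
  case 0
  then show ?case by simp
next
  case (Suc n)
  have IH: "real n * f a \<le> (real n - real a) * f 0 + real a * f n" if "a \<le> n" for a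
    using Suc.IH[OF _ that] Suc.prems(1) by simp
  show ?case
  proof (cases "a = Suc n \<or> n = 0")
    case True
    then show ?thesis using \<open>a \<le> Suc n\<close> by (cases a) auto
  next
    case False
    then obtain b where n: "n = Suc b" using not0_implies_Suc by auto
    from False Suc.prems have a: "a \<le> n" by simp
    have "real n * f b \<le> f 0 + real b * f n"
      using IH[of b] n by (simp add: algebra_simps)
    moreover have "2 * f n \<le> f b + f (Suc n)"
      using Suc.prems(1)[of b] n by simp
    then have "real n * (2 * f n) \<le> real n * (f b + f (Suc n))"
      by (rule mult_left_mono) simp
    ultimately have last: "(real n + 1) * f n \<le> f 0 + real n * f (Suc n)"
      using n by (simp add: algebra_simps)
    have "(real n + 1) * (real n * f a) \<le> (real n + 1) * ((real n - real a) * f 0 + real a * f n)"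
      by (rule mult_left_mono[OF IH[OF a]]) simp
    also have "\<dots> = (real n + 1) * (real n - real a) * f 0 + real a * ((real n + 1) * f n)"
      by (simp add: algebra_simps)
    also have "\<dots> \<le> (real n + 1) * (real n - real a) * f 0 + real a * (f 0 + real n * f (Suc n))"
      using last by (intro add_left_mono mult_left_mono) auto
    also have "\<dots> = real n * ((real (Suc n) - real a) * f 0 + real a * f (Suc n))"
      by (simp add: algebra_simps)
    finally have "real n * (real (Suc n) * f a) \<le> real n * ((real (Suc n) - real a) * f 0 + real a * f (Suc n))"
      by (simp add: algebra_simps)
    then show ?thesis using False by (simp add: mult_le_cancel_left)
  qed
qed

lemma linear_funpow:
  fixes L :: "'a::real_vector \<Rightarrow> 'a"
  assumes "linear L" shows "linear (L ^^ n)"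
proof (induction n)
  case 0
  then show ?case by (simp add: linear_iff)
next
  case (Suc n)
  then show ?case using linear_compose[OF Suc assms] by (simp add: o_def)
qed

lemma funpow_commute:
  assumes "\<And>x. L (R x) = R (L x)"
  shows "(L ^^ m) ((R ^^ n) x) = (R ^^ n) ((L ^^ m) x)"
proof -
  have "(L ^^ m) (R y) = R ((L ^^ m) y)" for y
    by (induction m) (simp_all add: assms)
  then show ?thesis
    by (induction n) simp_all
qed

text \<open>The factorization of \<open>a^(n+1) - b^(n+1)\<close> for commuting operators. Left
  multiplication by one matrix and right multiplication by another always commute, so it covers
  matrices that do not.\<close>

lemma funpow_diff_telescope:
  fixes L R :: "'a::real_vector \<Rightarrow> 'a"
  assumes "linear L" "linear R" and "\<And>x. L (R x) = R (L x)"
  shows "(L ^^ Suc n) x - (R ^^ Suc n) x = (\<Sum>j\<le>n. (L ^^ j) ((R ^^ (n - j)) (L x - R x)))"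
proof -
  have "(L ^^ j) ((R ^^ (n - j)) (L x - R x)) =
      (L ^^ Suc j) ((R ^^ (n - j)) x) - (L ^^ j) ((R ^^ (Suc n - j)) x)" if "j \<le> n" for j
  proof -
    have "(R ^^ (n - j)) (L x) = L ((R ^^ (n - j)) x)"
      using funpow_commute[of L R 1 "n - j" x] assms(3) by simp
    then show ?thesis
      using that by (simp add: linear_diff linear_funpow assms(1,2) funpow_swap1 Suc_diff_le)
  qed
  then have "(\<Sum>j\<le>n. (L ^^ j) ((R ^^ (n - j)) (L x - R x))) =
      (\<Sum>j\<le>n. (L ^^ Suc j) ((R ^^ (Suc n - Suc j)) x) - (L ^^ j) ((R ^^ (Suc n - j)) x))"
    by (intro sum.cong) auto
  also have "\<dots> = (L ^^ Suc n) x - (R ^^ Suc n) x"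
    using sum_telescope[of "\<lambda>j. - (L ^^ j) ((R ^^ (Suc n - j)) x)" n] by (simp add: atMost_Suc)
  finally show ?thesis ..
qed

section \<open>Positive semidefinite bilinear forms and their self-adjoint operators\<close>

locale psd_form =
  fixes B :: "'a::real_vector \<Rightarrow> 'a \<Rightarrow> real"
  assumes linear_right: "linear (B x)"
    and symm: "B x y = B y x"
    and nonneg: "0 \<le> B x x"
begin

lemma add_right: "B x (y + z) = B x y + B x z"
  and diff_right: "B x (y - z) = B x y - B x z"
  and scale_right: "B x (r *\<^sub>R y) = r * B x y"
  and sum_right: "B x (sum f A) = (\<Sum>i\<in>A. B x (f i))"
  and zero_right: "B x 0 = 0"
  using linear_add[OF linear_right] linear_diff[OF linear_right] linear_scale[OF linear_right]
    linear_sum[OF linear_right] linear_0[OF linear_right] by auto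

lemma add_left: "B (x + y) z = B x z + B y z"
  and diff_left: "B (x - y) z = B x z - B y z"
  and scale_left: "B (r *\<^sub>R x) z = r * B x z"
  and sum_left: "B (sum f A) z = (\<Sum>i\<in>A. B (f i) z)"
  and zero_left: "B 0 z = 0"
  by (simp_all add: symm[of _ z] add_right diff_right scale_right sum_right zero_right)

lemmas expand = add_right diff_right scale_right zero_right add_left diff_left scale_left zero_left

lemma diff_diff: "B (x - y) (x - y) = B x x - 2 * B x y + B y y"
  by (simp add: expand symm[of y x])

lemma twice_le: "2 * B x y \<le> B x x + B y y"
  using nonneg[of "x - y"] by (simp add: expand symm[of y x])

lemma diff_diff_le: "B (x - y) (x - y) \<le> 2 * B x x + 2 * B y y"
  using nonneg[of "x + y"] by (simp add: expand symm[of y x])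

lemma Cauchy_Schwarz: "(B x y)\<^sup>2 \<le> B x x * B y y"
proof (cases "B x x = 0")
  case True
  have "0 \<le> B y y - 2 * t * B x y" for t
    using nonneg[of "y - t *\<^sub>R x"] True by (simp add: expand symm[of y x])
  \<comment> \<open>This value of \<open>t\<close> makes the right-hand side equal to -1 unless
    \<open>B x y = 0\<close>.\<close>
  then have "0 \<le> B y y - 2 * ((B y y + 1) / (2 * B x y)) * B x y" .
  then have "B x y = 0" by (cases "B x y = 0") auto
  then show ?thesis using True by simp
next
  case False
  then have pos: "0 < B x x" using nonneg[of x] by simp
  have "0 \<le> B (B x x *\<^sub>R y - B x y *\<^sub>R x) (B x x *\<^sub>R y - B x y *\<^sub>R x)" by (rule nonneg)
  also have "\<dots> = B x x * (B x x * B y y - (B x y)\<^sup>2)"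
    by (simp add: expand symm[of y x] algebra_simps power2_eq_square)
  finally show ?thesis using pos by (simp add: zero_le_mult_iff)
qed

definition self_adjoint :: "('a \<Rightarrow> 'a) \<Rightarrow> bool"
  where "self_adjoint L \<longleftrightarrow> linear L \<and> (\<forall>x y. B (L x) y = B x (L y))"

lemma self_adjoint_funpow:
  assumes "self_adjoint L" shows "B ((L ^^ n) x) y = B x ((L ^^ n) y)"
  
proof (induction n arbitrary: y)
  case (Suc n)
  have "B ((L ^^ Suc n) x) y = B ((L ^^ n) x) (L y)"
    using assms by (simp add: self_adjoint_def)
  then show ?case by (simp add: Suc funpow_swap1)
qed simp

text \<open>Each term is at most its chord between the two end terms: the terms with even index form a
  convex sequence, and a term with odd index is at most the mean of its neighbours.\<close>

lemma sum_powers_le: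
  assumes L: "self_adjoint L" and R: "self_adjoint R" and comm: "\<And>x. L (R x) = R (L x)"
  shows "(\<Sum>j\<le>2 * n. B x ((L ^^ j) ((R ^^ (2 * n - j)) x)))
    \<le> (2 * real n + 1) / 2 * (B x ((L ^^ (2 * n)) x) + B x ((R ^^ (2 * n)) x))"
proof -
  define h where "h j = B x ((L ^^ j) ((R ^^ (2 * n - j)) x))" for j
  \<comment> \<open>Self-adjointness and commutation move all powers to one side, so these Gram
    entries depend on \<open>a + b\<close> only. Then \<open>twice_le\<close> compares
    \<open>h (a + b)\<close> with two even terms.\<close>
  have h_add: "B ((L ^^ a) ((R ^^ (n - a)) x)) ((L ^^ b) ((R ^^ (n - b)) x)) = h (a + b)"
    if "a \<le> n" "b \<le> n" for a b
  proof -
    have "B ((L ^^ a) ((R ^^ (n - a)) x)) ((L ^^ b) ((R ^^ (n - b)) x)) =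
        B x ((R ^^ (n - a)) ((L ^^ a) ((L ^^ b) ((R ^^ (n - b)) x))))"
      by (simp add: self_adjoint_funpow L R)
    also have "\<dots> = B x ((L ^^ (a + b)) ((R ^^ (n - a)) ((R ^^ (n - b)) x)))"
      by (simp add: funpow_commute[of L R, OF comm] funpow_add)
    also have "(R ^^ (n - a)) ((R ^^ (n - b)) x) = (R ^^ (2 * n - (a + b))) x"
    proof -
      have "2 * n - (a + b) = (n - a) + (n - b)" using that by simp
      then show ?thesis by (simp only: funpow_add o_apply)
    qed
    finally show ?thesis by (simp add: h_def)
  qed
  have mid: "2 * h (a + b) \<le> h (2 * a) + h (2 * b)" if "a \<le> n" "b \<le> n" for a b
    using twice_le[of "(L ^^ a) ((R ^^ (n - a)) x)" "(L ^^ b) ((R ^^ (n - b)) x)"] that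
    by (simp add: h_add flip: mult_2)
  have even: "real n * h (2 * a) \<le> (real n - real a) * h 0 + real a * h (2 * n)" if "a \<le> n" for a
  proof -
    have "2 * h (2 * (a + 1)) \<le> h (2 * a) + h (2 * (a + 2))" if "a + 1 < n" for a
    proof -
      have "2 * (a + 1) = a + (a + 2)" by simp
      then show ?thesis using mid[of a "a + 2"] that by (simp only:)
    qed
    from discrete_convex_chord[of n "\<lambda>a. h (2 * a)", OF this that] show ?thesis by simp
  qed
  have chord: "2 * real n * h j \<le> (2 * real n - real j) * h 0 + real j * h (2 * n)" if "j \<le> 2 * n" for j
  proof (cases "even j")
    case True
    then obtain a where "j = 2 * a" by (elim evenE)
    then show ?thesis using even[of a] that by (simp add: algebra_simps)
  next
    case False
    then obtain a where a: "j = 2 * a + 1" by (elim oddE)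
    then have "real n * (2 * h j) \<le> real n * (h (2 * a) + h (2 * (a + 1)))"
      using mid[of a "a + 1"] that by (intro mult_left_mono) (simp_all flip: mult_2)
    also have "\<dots> \<le> (2 * real n - real j) * h 0 + real j * h (2 * n)"
      using even[of a] even[of "a + 1"] that a by (simp add: algebra_simps)
    finally show ?thesis by simp
  qed
  \<comment> \<open>The chord sums to \<open>2 * n + 1\<close> times the mean of its end values. The
    factor \<open>2 * real n\<close> can be cancelled only for positive \<open>n\<close>; the case
    \<open>n = 0\<close> is checked directly.\<close>
  have "2 * real n * (\<Sum>j\<le>2 * n. h j) \<le> (\<Sum>j\<le>2 * n. (2 * real n - real j) * h 0 + real j * h (2 * n))"
    unfolding sum_distrib_left by (intro sum_mono chord) simp
  also have "\<dots> = ((\<Sum>j\<le>2 * n. 2 * real n) - (\<Sum>j\<le>2 * n. real j)) * h 0 + (\<Sum>j\<le>2 * n. real j) * h (2 * n)"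
    by (simp add: sum.distrib sum_subtractf sum_distrib_right left_diff_distrib)
  also have "(\<Sum>j\<le>2 * n. real j) = real n * (2 * real n + 1)"
    using double_gauss_sum[of "2 * n", where 'a = real] by (simp add: atMost_atLeast0)
  also have "((\<Sum>j\<le>2 * n. 2 * real n) - real n * (2 * real n + 1)) * h 0 + real n * (2 * real n + 1) * h (2 * n) =
      2 * real n * ((2 * real n + 1) / 2 * (h (2 * n) + h 0))"
    by (simp add: algebra_simps)
  finally have *: "2 * real n * (\<Sum>j\<le>2 * n. h j) \<le> 2 * real n * ((2 * real n + 1) / 2 * (h (2 * n) + h 0))" .
  have "(\<Sum>j\<le>2 * n. h j) \<le> (2 * real n + 1) / 2 * (h (2 * n) + h 0)" if "0 < n"
    using mult_left_le_imp_le[OF *] that by simp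
  moreover have "h 0 = B x ((R ^^ (2 * n)) x)" "h (2 * n) = B x ((L ^^ (2 * n)) x)"
    by (simp_all add: h_def)
  ultimately show ?thesis by (cases "n = 0") (simp_all add: h_def)
qed

text \<open>Cauchy-Schwarz makes the squared norms \<open>g j\<close> of \<open>(L ^^ j) x\<close>
  log-convex, so each ratio of successive terms is at least the first ratio. Multiplying these
  ratios up gives the bound.\<close>

lemma power_form_le:
  assumes L: "self_adjoint L"
  shows "B (L x) (L x) ^ Suc p \<le> B x x ^ p * B ((L ^^ Suc p) x) ((L ^^ Suc p) x)"
proof -
  define g where "g j = B ((L ^^ j) x) ((L ^^ j) x)" for j
  have g0: "0 \<le> g j" for j by (simp add: g_def nonneg)
  have "(g (Suc j))\<^sup>2 \<le> g j * g (Suc (Suc j))" for j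
  proof -
    have "g (Suc j) = B ((L ^^ j) x) ((L ^^ Suc (Suc j)) x)"
      using L by (simp add: g_def self_adjoint_def)
    then show ?thesis
      using Cauchy_Schwarz[of "(L ^^ j) x" "(L ^^ Suc (Suc j)) x"] by (simp add: g_def)
  qed
  then have g2: "g (Suc j) * g (Suc j) \<le> g j * g (Suc (Suc j))" for j
    by (simp add: power2_eq_square)
  \<comment> \<open>Stated without division because \<open>g j\<close> may vanish. In the induction,
    a nonzero \<open>g (Suc j)\<close> forces \<open>g j\<close> to be positive, which allows the
    cancellation.\<close>
  have ratio: "g 1 * g j \<le> g 0 * g (Suc j)" for j
  proof (induction j)
    case (Suc j)
    show ?case
    proof (cases "g (Suc j) = 0")
      case False
      then have "0 < g j * g (Suc (Suc j))" using g2[of j] g0[of "Suc j"]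
        by (metis less_le_trans mult_pos_pos order_le_less)
      then have pos: "0 < g j" using g0[of j] by (auto simp: zero_less_mult_iff)
      have "g j * (g 1 * g (Suc j)) = g 1 * g j * g (Suc j)" by simp
      also have "\<dots> \<le> g 0 * g (Suc j) * g (Suc j)"
        by (rule mult_right_mono[OF Suc g0])
      also have "\<dots> \<le> g 0 * (g j * g (Suc (Suc j)))"
        using g2[of j] g0[of 0] by (simp only: mult.assoc mult_left_mono)
      finally show ?thesis using pos by (simp add: mult.left_commute[of "g 0"])
    qed (simp add: g0)
  qed simp
  have "g 1 ^ Suc p \<le> g 0 ^ p * g (Suc p)"
  proof (induction p)
    case (Suc p)
    have "g 1 ^ Suc (Suc p) \<le> g 1 * (g 0 ^ p * g (Suc p))"
      using mult_left_mono[OF Suc g0[of 1]] by simp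
    also have "\<dots> = g 0 ^ p * (g 1 * g (Suc p))" by simp
    also have "\<dots> \<le> g 0 ^ p * (g 0 * g (Suc (Suc p)))"
      by (intro mult_left_mono ratio zero_le_power g0)
    finally show ?case by (simp add: mult.assoc mult.left_commute)
  qed simp
  then show ?thesis by (simp add: g_def)
qed

end

section \<open>Independent sampling\<close>

locale sampling =
  fixes I :: "'i set" and \<alpha> :: "'i \<Rightarrow> real" and k :: nat
  assumes finite_I: "finite I"
    and weight_nonneg: "i \<in> I \<Longrightarrow> 0 \<le> \<alpha> i"
    and weight_sum: "(\<Sum>i\<in>I. \<alpha> i) = 1"
begin

text \<open>Extensional functions form a finite set, so the expectation over \<open>k\<close>
  independent draws is a finite weighted sum.\<close>

definition seqs :: "(nat \<Rightarrow> 'i) set"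
  where "seqs = {..<k} \<rightarrow>\<^sub>E I"

definition expect :: "((nat \<Rightarrow> 'i) \<Rightarrow> real) \<Rightarrow> real"
  where "expect F = (\<Sum>s\<in>seqs. (\<Prod>i<k. \<alpha> (s i)) * F s)"

lemma finite_seqs: "finite seqs"
  by (simp add: seqs_def finite_PiE finite_I)

lemma seqs_mem: "s \<in> seqs \<Longrightarrow> i < k \<Longrightarrow> s i \<in> I"
  by (auto simp: seqs_def)

lemma expect_const: "expect (\<lambda>s. c) = c"
proof -
  have "(\<Sum>s\<in>seqs. \<Prod>i<k. \<alpha> (s i)) = (\<Prod>i<k. \<Sum>l\<in>I. \<alpha> l)"
    unfolding seqs_def by (rule prod_sum_PiE[symmetric]) (auto simp: finite_I)
  then show ?thesis
    by (simp add: expect_def weight_sum flip: sum_distrib_right)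
qed

lemma expect_add: "expect (\<lambda>s. F s + G s) = expect F + expect G"
  by (simp add: expect_def ring_distribs sum.distrib)

lemma expect_cmult: "expect (\<lambda>s. c * F s) = c * expect F"
  by (simp add: expect_def sum_distrib_left mult.left_commute)

lemma expect_sum: "expect (\<lambda>s. \<Sum>j\<in>A. F j s) = (\<Sum>j\<in>A. expect (F j))"
  by (simp add: expect_def sum_distrib_left) (rule sum.swap)

lemma expect_mono:
  assumes "\<And>s. s \<in> seqs \<Longrightarrow> F s \<le> G s" shows "expect F \<le> expect G"
  unfolding expect_def using assms
  by (intro sum_mono mult_left_mono prod_nonneg) (auto intro: weight_nonneg seqs_mem)

lemma expect_cong:
  assumes "\<And>s. s \<in> seqs \<Longrightarrow> F s = G s" shows "expect F = expect G"
  using assms by (simp add: expect_def)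

text \<open>The first-moment method: the minimum over the finite nonempty sample space is at most
  the mean.\<close>

lemma expect_attained:
  assumes "expect F \<le> c" obtains s where "s \<in> seqs" "F s \<le> c"
proof (rule ccontr)
  assume "\<not> thesis"
  with that have less: "c < F s" if "s \<in> seqs" for s
    using \<open>s \<in> seqs\<close> by force
  have "seqs \<noteq> {}"
    using expect_const[of 1] by (auto simp: expect_def)
  then have ne: "F ` seqs \<noteq> {}" by simp
  have "Min (F ` seqs) \<le> expect F"
    using expect_mono[of "\<lambda>s. Min (F ` seqs)" F] finite_seqs by (simp add: expect_const)
  moreover have "c < Min (F ` seqs)"
    using ne less finite_seqs by simp
  ultimately show False using assms by simp
qed

text \<open>Here \<open>l\<close> is a fresh draw, independent of \<open>s\<close>. Swapping it with
  \<open>s i\<close> is an involution of \<open>seqs \<times> I\<close> that preserves the weights,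
  so the pair is exchangeable.\<close>

lemma expect_exchange:
  assumes "i < k"
  shows "expect (\<lambda>s. \<Sum>l\<in>I. \<alpha> l * G s l) = expect (\<lambda>s. \<Sum>l\<in>I. \<alpha> l * G (s(i := l)) (s i))"
proof -
  define P where "P s = (\<Prod>j\<in>{..<k} - {i}. \<alpha> (s j))" for s
  have split: "(\<Prod>j<k. \<alpha> (s j)) = \<alpha> (s i) * P s" for s
    using assms by (simp add: P_def prod.remove[of "{..<k}" i])
  have P_upd: "P (s(i := l)) = P s" for s l
    unfolding P_def by (intro prod.cong) auto
  have to_pairs: "expect (\<lambda>s. \<Sum>l\<in>I. \<alpha> l * H s l) =
      (\<Sum>(s, l)\<in>seqs \<times> I. P s * (\<alpha> (s i) * \<alpha> l) * H s l)" for H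
    by (simp add: expect_def split sum_distrib_left mult_ac flip: sum.cartesian_product)
  have upd_mem: "s(i := l) \<in> seqs" if "s \<in> seqs" "l \<in> I" for s l
    using that assms by (auto simp: seqs_def PiE_iff extensional_def)
  define sw where "sw = (\<lambda>(s :: nat \<Rightarrow> 'i, l). (s(i := l), s i))"
  have sw: "sw p \<in> seqs \<times> I" "sw (sw p) = p" if "p \<in> seqs \<times> I" for p
    using that assms by (auto simp: sw_def upd_mem seqs_mem)
  show ?thesis
    unfolding to_pairs
  proof (rule sum.reindex_bij_witness[where i = sw and j = sw])
    fix p assume p: "p \<in> seqs \<times> I"
    show "sw p \<in> seqs \<times> I" "sw (sw p) = p" "sw p \<in> seqs \<times> I" "sw (sw p) = p"
      using sw p by simp_all
    show "(case sw p of (s, l) \<Rightarrow> P s * (\<alpha> (s i) * \<alpha> l) * G (s(i := l)) (s i)) =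
        (case p of (s, l) \<Rightarrow> P s * (\<alpha> (s i) * \<alpha> l) * G s l)"
      by (cases p) (simp add: sw_def P_upd)
  qed
qed

lemma expect_coordinate:
  assumes "i < k" shows "expect (\<lambda>s. g (s i)) = (\<Sum>l\<in>I. \<alpha> l * g l)"
proof -
  have "expect (\<lambda>s. g (s i)) = expect (\<lambda>s. \<Sum>l\<in>I. \<alpha> l * g (s i))"
    by (simp add: weight_sum flip: sum_distrib_right)
  also have "\<dots> = expect (\<lambda>s. \<Sum>l\<in>I. \<alpha> l * g l)"
    by (subst expect_exchange[OF assms]) simp
  finally show ?thesis by (simp add: expect_const)
qed

text \<open>Since the \<open>x l\<close> have mean 0, \<open>x (s i)\<close> may be replaced by
  \<open>x (s i) - x l\<close> for a fresh draw \<open>l\<close>. Exchanging the two draws flips the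
  sign of this difference, and adding both expressions leaves the increment of
  \<open>F\<close>.\<close>

lemma expect_centered_coordinate:
  assumes "psd_form B" and "i < k" and centered: "(\<Sum>l\<in>I. \<alpha> l *\<^sub>R x l) = 0"
  shows "2 * expect (\<lambda>s. B (x (s i)) (F s)) =
    expect (\<lambda>s. \<Sum>l\<in>I. \<alpha> l * B (x (s i) - x l) (F s - F (s(i := l))))"
proof -
  interpret psd_form B by fact
  have "(\<Sum>l\<in>I. \<alpha> l * B (x (s i) - x l) (F s)) = B (x (s i)) (F s)" for s
  proof -
    have "(\<Sum>l\<in>I. \<alpha> l * B (x (s i) - x l) (F s)) =
        (\<Sum>l\<in>I. \<alpha> l) * B (x (s i)) (F s) - B (\<Sum>l\<in>I. \<alpha> l *\<^sub>R x l) (F s)"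
      by (simp add: sum_left expand right_diff_distrib sum_subtractf sum_distrib_right)
    then show ?thesis by (simp add: weight_sum centered expand)
  qed
  then have 1: "expect (\<lambda>s. B (x (s i)) (F s)) =
      expect (\<lambda>s. \<Sum>l\<in>I. \<alpha> l * B (x (s i) - x l) (F s))"
    by simp
  also have "\<dots> = expect (\<lambda>s. \<Sum>l\<in>I. \<alpha> l * B (x l - x (s i)) (F (s(i := l))))"
    by (subst expect_exchange[OF assms(2)]) simp
  finally have "2 * expect (\<lambda>s. B (x (s i)) (F s)) =
      expect (\<lambda>s. \<Sum>l\<in>I. \<alpha> l * B (x (s i) - x l) (F s)) +
      expect (\<lambda>s. \<Sum>l\<in>I. \<alpha> l * B (x l - x (s i)) (F (s(i := l))))"
    using 1 by simp
  then show ?thesis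
    by (simp add: expand algebra_simps flip: expect_add sum.distrib)
qed

text \<open>Additivity of the variance: resampling one coordinate changes the sum by exactly
  \<open>x (s i) - x l\<close>, whose mean square is twice the second moment of one term.\<close>

lemma expect_centered_sum:
  assumes "psd_form B" and centered: "(\<Sum>l\<in>I. \<alpha> l *\<^sub>R x l) = 0"
  shows "expect (\<lambda>s. B (\<Sum>i<k. x (s i)) (\<Sum>i<k. x (s i))) = real k * (\<Sum>l\<in>I. \<alpha> l * B (x l) (x l))"
proof -
  interpret psd_form B by fact
  define q where "q = (\<Sum>l\<in>I. \<alpha> l * B (x l) (x l))"
  have "2 * expect (\<lambda>s. B (x (s i)) (\<Sum>i<k. x (s i))) = 2 * q" if "i < k" for i
  proof -
    have upd: "(\<Sum>j<k. x (s j)) - (\<Sum>j<k. x ((s(i := l)) j)) = x (s i) - x l" for s l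
      using that by (simp add: sum.remove[of "{..<k}" i])
    have "2 * expect (\<lambda>s. B (x (s i)) (\<Sum>i<k. x (s i))) =
        expect (\<lambda>s. \<Sum>l\<in>I. \<alpha> l * B (x (s i) - x l) (x (s i) - x l))"
      unfolding expect_centered_coordinate[OF assms(1) that centered] upd ..
    also have "\<dots> = expect (\<lambda>s. B (x (s i)) (x (s i)) + q)"
    proof (rule expect_cong)
      fix s
      have "(\<Sum>l\<in>I. \<alpha> l * B (x (s i) - x l) (x (s i) - x l)) =
          (\<Sum>l\<in>I. \<alpha> l) * B (x (s i)) (x (s i)) + q - 2 * B (x (s i)) (\<Sum>l\<in>I. \<alpha> l *\<^sub>R x l)"
      proof -
        have "\<alpha> l * B (x (s i) - x l) (x (s i) - x l) =
            \<alpha> l * B (x (s i)) (x (s i)) + \<alpha> l * B (x l) (x l) - 2 * B (x (s i)) (\<alpha> l *\<^sub>R x l)" for l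
          by (simp only: diff_diff scale_right) algebra
        then show ?thesis
          by (simp add: sum_right q_def sum_distrib_right sum_distrib_left sum_subtractf sum.distrib)
      qed
      then show "(\<Sum>l\<in>I. \<alpha> l * B (x (s i) - x l) (x (s i) - x l)) = B (x (s i)) (x (s i)) + q"
        by (simp add: weight_sum centered expand)
    qed
    also have "\<dots> = 2 * q"
      using expect_coordinate[OF that, of "\<lambda>l. B (x l) (x l)"] by (simp add: expect_add expect_const q_def)
    finally show ?thesis .
  qed
  then show ?thesis
    by (simp add: sum_left expect_sum q_def)
qed

text \<open>Centring lowers the second moment by \<open>B m m\<close>, which is nonnegative, so a
  bound on the uncentred terms suffices.\<close>

lemma expect_sum_deviation_le:
  fixes x :: "'i \<Rightarrow> 'a::real_vector"
  assumes "psd_form B" and le: "\<And>l. l \<in> I \<Longrightarrow> B (x l) (x l) \<le> c"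
  defines "m \<equiv> \<Sum>l\<in>I. \<alpha> l *\<^sub>R x l"
  shows "expect (\<lambda>s. B (\<Sum>i<k. x (s i) - m) (\<Sum>i<k. x (s i) - m)) \<le> real k * c"
proof -
  interpret psd_form B by fact
  have "(\<Sum>l\<in>I. \<alpha> l *\<^sub>R (x l - m)) = m - (\<Sum>l\<in>I. \<alpha> l) *\<^sub>R m"
    by (simp add: m_def scaleR_diff_right sum_subtractf scaleR_left.sum)
  then have centered: "(\<Sum>l\<in>I. \<alpha> l *\<^sub>R (x l - m)) = 0" by (simp add: weight_sum)
  have "(\<Sum>l\<in>I. \<alpha> l * B (x l - m) (x l - m)) =
      (\<Sum>l\<in>I. \<alpha> l * B (x l) (x l)) - 2 * B (\<Sum>l\<in>I. \<alpha> l *\<^sub>R x l) m + (\<Sum>l\<in>I. \<alpha> l) * B m m"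
  proof -
    have "\<alpha> l * B (x l - m) (x l - m) =
        \<alpha> l * B (x l) (x l) - 2 * B (\<alpha> l *\<^sub>R x l) m + \<alpha> l * B m m" for l
      by (simp only: diff_diff scale_left) algebra
    then show ?thesis
      by (simp add: sum_left sum_distrib_right sum_distrib_left sum_subtractf sum.distrib)
  qed
  also have "\<dots> \<le> (\<Sum>l\<in>I. \<alpha> l * B (x l) (x l))"
    using nonneg[of m] by (simp add: weight_sum flip: m_def)
  also have "\<dots> \<le> (\<Sum>l\<in>I. \<alpha> l * c)"
    by (intro sum_mono mult_left_mono le weight_nonneg)
  also have "\<dots> = c" by (simp add: weight_sum flip: sum_distrib_right)
  finally show ?thesis
    by (simp add: expect_centered_sum[OF assms(1) centered] mult_left_mono)
qed

end

section \<open>Matrices of variable size\<close>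

text \<open>The Hilbert-Schmidt form: the trace of the transpose of \<open>P\<close> times
  \<open>Q\<close>, taken on the leading \<open>d\<close> by \<open>d\<close> block.\<close>

definition hs :: "nat \<Rightarrow> (nat \<Rightarrow> nat \<Rightarrow> real) \<Rightarrow> (nat \<Rightarrow> nat \<Rightarrow> real) \<Rightarrow> real"
  where "hs d P Q = (\<Sum>i<d. ip d (P i) (Q i))"

definition mmul :: "nat \<Rightarrow> (nat \<Rightarrow> nat \<Rightarrow> real) \<Rightarrow> (nat \<Rightarrow> nat \<Rightarrow> real) \<Rightarrow> nat \<Rightarrow> nat \<Rightarrow> real"
  where "mmul d P Q = (\<lambda>i j. \<Sum>l<d. P i l * Q l j)"

definition mvec :: "nat \<Rightarrow> (nat \<Rightarrow> nat \<Rightarrow> real) \<Rightarrow> (nat \<Rightarrow> real) \<Rightarrow> nat \<Rightarrow> real"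
  where "mvec d P x = (\<lambda>i. ip d (P i) x)"

definition unit_matrix :: "nat \<Rightarrow> nat \<Rightarrow> nat \<Rightarrow> real"
  where "unit_matrix d = (\<lambda>i j. of_bool (i = j \<and> i < d))"

text \<open>The matrix of \<open>tensor d y x\<close>; note the reversed order of the
  arguments.\<close>

definition outer :: "(nat \<Rightarrow> real) \<Rightarrow> (nat \<Rightarrow> real) \<Rightarrow> nat \<Rightarrow> nat \<Rightarrow> real"
  where "outer x y = (\<lambda>i j. x i * y j)"

text \<open>Matrices are total functions of two indices; on those supported in the leading block
  \<open>unit_matrix d\<close> is a two-sided unit.\<close>

definition matrices :: "nat \<Rightarrow> (nat \<Rightarrow> nat \<Rightarrow> real) set"
  where "matrices d = {P. \<forall>i j. d \<le> i \<or> d \<le> j \<longrightarrow> P i j = 0}"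

definition symmetric :: "(nat \<Rightarrow> nat \<Rightarrow> real) \<Rightarrow> bool"
  where "symmetric P \<longleftrightarrow> (\<forall>i j. P i j = P j i)"

lemma scaleR_fun_apply [simp]: "(r *\<^sub>R f) x = r *\<^sub>R f x"
  by (simp add: scaleR_fun_def)

lemma sum_fun_apply: "(\<Sum>i\<in>A. f i) x = (\<Sum>i\<in>A. f i x)"
  for f :: "'i \<Rightarrow> 'a \<Rightarrow> 'b::ab_group_add"
  by (induction A rule: infinite_finite_induct) simp_all

text \<open>Like \<open>hs d\<close>, this form ignores entries with index at least
  \<open>d\<close>, so on total functions it is semidefinite but not definite.\<close>

lemma psd_form_ip: "psd_form (ip d)"
  by standard (auto simp: linear_iff ip_def distrib_left sum.distrib sum_distrib_left mult_ac intro: sum_nonneg)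

lemma psd_form_hs: "psd_form (hs d)"
proof -
  interpret ip: psd_form "ip d" by (rule psd_form_ip)
  show ?thesis
    by standard (auto simp: linear_iff hs_def ip.expand sum.distrib sum_distrib_left ip.symm
        ip.nonneg intro: sum_nonneg)
qed

interpretation ip: psd_form "ip d" for d by (rule psd_form_ip)
interpretation hs: psd_form "hs d" for d by (rule psd_form_hs)

section \<open>Matrix products and the Hilbert-Schmidt form\<close>

lemma hs_expand: "hs d P Q = (\<Sum>i<d. \<Sum>j<d. P i j * Q i j)"
  by (simp add: hs_def ip_def)

lemma mmul_assoc: "mmul d (mmul d P Q) S = mmul d P (mmul d Q S)"
  by (auto simp: mmul_def fun_eq_iff sum_distrib_left sum_distrib_right mult.assoc intro: sum.swap)

lemma linear_mmul_left: "linear (mmul d P)"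
  by (simp add: linear_iff mmul_def fun_eq_iff distrib_left sum.distrib sum_distrib_left mult_ac)

lemma linear_mmul_right: "linear (\<lambda>Q. mmul d Q P)"
  by (simp add: linear_iff mmul_def fun_eq_iff algebra_simps sum.distrib sum_distrib_left)

lemma hs_mmul_left:
  assumes "symmetric P" shows "hs d (mmul d P Q) S = hs d Q (mmul d P S)"
proof -
  have "hs d (mmul d P Q) S = (\<Sum>i<d. \<Sum>j<d. \<Sum>l<d. P i l * Q l j * S i j)"
    by (simp add: hs_expand mmul_def sum_distrib_right)
  also have "\<dots> = (\<Sum>i<d. \<Sum>l<d. \<Sum>j<d. P i l * Q l j * S i j)"
    by (intro sum.cong refl sum.swap)
  also have "\<dots> = (\<Sum>l<d. \<Sum>i<d. \<Sum>j<d. P i l * Q l j * S i j)"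
    by (rule sum.swap)
  also have "\<dots> = (\<Sum>l<d. \<Sum>j<d. \<Sum>i<d. Q l j * (P l i * S i j))"
  proof (rule sum.cong[OF refl])
    fix l
    show "(\<Sum>i<d. \<Sum>j<d. P i l * Q l j * S i j) = (\<Sum>j<d. \<Sum>i<d. Q l j * (P l i * S i j))"
      using assms by (subst sum.swap) (simp add: symmetric_def mult_ac)
  qed
  finally show ?thesis by (simp add: hs_expand mmul_def sum_distrib_left)
qed

lemma hs_transpose: "hs d (\<lambda>i j. P j i) (\<lambda>i j. Q j i) = hs d P Q"
  unfolding hs_expand by (rule sum.swap)

lemma mmul_transpose: "mmul d (\<lambda>i j. P j i) (\<lambda>i j. Q j i) = (\<lambda>i j. mmul d Q P j i)"
  by (simp add: mmul_def mult.commute)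

text \<open>Transposition preserves \<open>hs d\<close> and turns right multiplication by
  \<open>P\<close> into left multiplication.\<close>

lemma hs_mmul_right:
  assumes "symmetric P" shows "hs d (mmul d Q P) S = hs d Q (mmul d S P)"
proof -
  have P: "(\<lambda>i j. P j i) = P" using assms by (simp add: symmetric_def fun_eq_iff)
  have "hs d (mmul d Q P) S = hs d (mmul d P (\<lambda>i j. Q j i)) (\<lambda>i j. S j i)"
    using hs_transpose[of d "mmul d Q P" S] mmul_transpose[of d P Q] P by simp
  also have "\<dots> = hs d (\<lambda>i j. Q j i) (mmul d P (\<lambda>i j. S j i))"
    by (rule hs_mmul_left[OF assms])
  also have "\<dots> = hs d Q (mmul d S P)"
    using hs_transpose[of d Q "mmul d S P"] mmul_transpose[of d P S] P by simp
  finally show ?thesis .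
qed

lemma self_adjoint_mmul_left: "symmetric P \<Longrightarrow> hs.self_adjoint d (mmul d P)"
  by (simp add: hs.self_adjoint_def linear_mmul_left hs_mmul_left)

lemma self_adjoint_mmul_right: "symmetric P \<Longrightarrow> hs.self_adjoint d (\<lambda>Q. mmul d Q P)"
  by (simp add: hs.self_adjoint_def linear_mmul_right hs_mmul_right)

lemma mmul_unit_right:
  assumes "P \<in> matrices d" shows "mmul d P (unit_matrix d) = P"
proof (intro ext)
  fix i j
  have "mmul d P (unit_matrix d) i j = (\<Sum>l<d. if l = j then P i j else 0)"
    unfolding mmul_def by (intro sum.cong) (auto simp: unit_matrix_def)
  then show "mmul d P (unit_matrix d) i j = P i j"
    using assms by (auto simp: matrices_def)
qed

lemma mmul_unit_left:
  assumes "P \<in> matrices d" shows "mmul d (unit_matrix d) P = P"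
proof (intro ext)
  fix i j
  have "mmul d (unit_matrix d) P i j = (\<Sum>l<d. if l = i then P i j else 0)"
    unfolding mmul_def by (intro sum.cong) (auto simp: unit_matrix_def)
  then show "mmul d (unit_matrix d) P i j = P i j"
    using assms by (auto simp: matrices_def)
qed

lemma matrices_diff: "P \<in> matrices d \<Longrightarrow> Q \<in> matrices d \<Longrightarrow> P - Q \<in> matrices d"
  and matrices_scale: "P \<in> matrices d \<Longrightarrow> r *\<^sub>R P \<in> matrices d"
  by (auto simp: matrices_def)

lemma matrices_sum: "(\<And>i. i \<in> A \<Longrightarrow> f i \<in> matrices d) \<Longrightarrow> sum f A \<in> matrices d"
  by (auto simp: matrices_def sum_fun_apply intro!: sum.neutral)

lemma symmetric_diff: "symmetric P \<Longrightarrow> symmetric Q \<Longrightarrow> symmetric (P - Q)"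
  and symmetric_scale: "symmetric P \<Longrightarrow> symmetric (r *\<^sub>R P)"
  by (auto simp: symmetric_def)

lemma symmetric_sum: "(\<And>i. i \<in> A \<Longrightarrow> symmetric (f i)) \<Longrightarrow> symmetric (sum f A)"
  by (auto simp: symmetric_def sum_fun_apply intro!: sum.cong)

lemma outer_in_matrices: "x \<in> eucl d \<Longrightarrow> y \<in> eucl d \<Longrightarrow> outer x y \<in> matrices d"
  by (auto simp: outer_def matrices_def topspace_Euclidean_space)

lemma symmetric_outer: "symmetric (outer x x)"
  by (simp add: symmetric_def outer_def)

lemma hs_outer: "hs d (outer x y) (outer x y) = ip d x x * ip d y y"
  by (simp add: hs_expand outer_def ip_def sum_product mult_ac)

lemma mmul_outer: "mmul d P (outer x y) = outer (mvec d P x) y"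
  by (simp add: mmul_def outer_def mvec_def ip_def sum_distrib_right mult.assoc)

text \<open>Turns squared lengths of images into expressions linear in \<open>outer x x\<close>, so
  that they can be summed and averaged over sampled vectors.\<close>

lemma hs_mmul_outer: "hs d P (mmul d P (outer x x)) = ip d (mvec d P x) (mvec d P x)"
proof -
  have "ip d (P i) (outer (mvec d P x) x i) = mvec d P x i * mvec d P x i" for i
    by (simp add: outer_def mvec_def[of d P x] ip_def sum_distrib_left mult_ac)
  then show ?thesis
    by (simp add: hs_def mmul_outer) (simp add: ip_def)
qed

text \<open>The form splits over the rows of \<open>P\<close>, and the bound on the quadratic form
  of \<open>M\<close> applies to each row.\<close>

lemma hs_mmul_le:
  assumes "\<And>x. ip d x (mvec d M x) \<le> \<mu> * ip d x x" and "symmetric M"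
  shows "hs d P (mmul d P M) \<le> \<mu> * hs d P P"
proof -
  have "ip d (P i) (mmul d P M i) = ip d (P i) (mvec d M (P i))" for i
    using assms(2) by (auto simp: mmul_def mvec_def ip_def symmetric_def mult.commute intro!: sum.cong)
  then show ?thesis
    using assms(1) by (simp add: hs_def sum_distrib_left sum_mono)
qed

section \<open>Matrices acting on vectors\<close>

lemma mvec_mmul: "mvec d (mmul d P Q) x = mvec d P (mvec d Q x)"
  by (auto simp: mvec_def mmul_def ip_def sum_distrib_left sum_distrib_right mult.assoc fun_eq_iff intro: sum.swap)

lemma mvec_outer: "mvec d (outer x y) z = ip d y z *\<^sub>R x"
  by (simp add: mvec_def outer_def ip_def sum_distrib_left fun_eq_iff mult_ac)

lemma mvec_add: "mvec d (P + Q) x = mvec d P x + mvec d Q x"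
  and mvec_diff: "mvec d (P - Q) x = mvec d P x - mvec d Q x"
  and mvec_scale: "mvec d (r *\<^sub>R P) x = r *\<^sub>R mvec d P x"
  by (simp_all add: mvec_def ip_def fun_eq_iff distrib_right left_diff_distrib sum.distrib sum_subtractf
      sum_distrib_left mult.assoc)

lemma mvec_sum: "mvec d (sum f A) x = (\<Sum>i\<in>A. mvec d (f i) x)"
  proof -
  have "mvec d 0 x = 0" by (simp add: mvec_def ip_def fun_eq_iff)
  then show ?thesis
    by (induction A rule: infinite_finite_induct) (simp_all add: mvec_add)
qed

lemma self_adjoint_mvec: "symmetric P \<Longrightarrow> ip.self_adjoint d (mvec d P)"
proof -
  assume P: "symmetric P"
  have "ip d (mvec d P x) y = ip d x (mvec d P y)" for x y
  proof -
    have "ip d (mvec d P x) y = (\<Sum>i<d. \<Sum>j<d. P i j * x j * y i)"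
      by (simp add: mvec_def ip_def sum_distrib_right)
    also have "\<dots> = (\<Sum>j<d. \<Sum>i<d. P i j * x j * y i)" by (rule sum.swap)
    also have "\<dots> = ip d x (mvec d P y)"
      using P by (auto simp: mvec_def ip_def sum_distrib_left symmetric_def mult_ac intro!: sum.cong)
    finally show ?thesis .
  qed
  then show ?thesis
    by (simp add: ip.self_adjoint_def linear_iff mvec_def ip.expand fun_eq_iff)
qed

text \<open>Cauchy-Schwarz on each row: the Hilbert-Schmidt norm dominates the operator
  norm.\<close>

lemma ip_mvec_le: "ip d (mvec d P x) (mvec d P x) \<le> hs d P P * ip d x x"
proof -
  have "ip d (mvec d P x) (mvec d P x) = (\<Sum>i<d. (ip d (P i) x)\<^sup>2)"
    by (simp add: mvec_def ip_def[of d "\<lambda>i. ip d (P i) x"] power2_eq_square)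
  also have "\<dots> \<le> (\<Sum>i<d. ip d (P i) (P i) * ip d x x)"
    by (intro sum_mono ip.Cauchy_Schwarz)
  finally show ?thesis by (simp add: hs_def sum_distrib_right)
qed

section \<open>Matrix powers and their traces\<close>

definition mpow :: "nat \<Rightarrow> (nat \<Rightarrow> nat \<Rightarrow> real) \<Rightarrow> nat \<Rightarrow> nat \<Rightarrow> nat \<Rightarrow> real"
  where "mpow d P n = (mmul d P ^^ n) (unit_matrix d)"

lemma mpow_0: "mpow d P 0 = unit_matrix d"
  and mpow_Suc: "mpow d P (Suc n) = mmul d P (mpow d P n)"
  by (simp_all add: mpow_def)

lemma hs_unit: "hs d (unit_matrix d) (unit_matrix d) = real d"
proof -
  have "(\<Sum>j<d. unit_matrix d i j * unit_matrix d i j) = 1" if "i < d" for i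
    using that by (simp add: unit_matrix_def of_bool_def if_distrib cong: if_cong)
  then show ?thesis by (simp add: hs_expand)
qed

lemma mpow_1: "P \<in> matrices d \<Longrightarrow> mpow d P 1 = P"
  by (simp add: mpow_Suc mpow_0 mmul_unit_right)

text \<open>Left and right multiplication by \<open>P\<close> commute and agree on the unit matrix.
  In \<open>hs_mpow_diff_le\<close> the powers of the second matrix are built from the
  right.\<close>

lemma mpow_eq_right:
  assumes "P \<in> matrices d" shows "mpow d P n = ((\<lambda>Q. mmul d Q P) ^^ n) (unit_matrix d)"
proof (induction n)
  case (Suc n)
  have "mpow d P (Suc n) = mmul d P (((\<lambda>Q. mmul d Q P) ^^ n) (unit_matrix d))"
    by (simp add: mpow_Suc Suc)
  also have "\<dots> = ((\<lambda>Q. mmul d Q P) ^^ n) (mmul d P (unit_matrix d))"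
    using funpow_commute[of "mmul d P" "\<lambda>Q. mmul d Q P" 1 n "unit_matrix d"] by (simp add: mmul_assoc)
  also have "mmul d P (unit_matrix d) = mmul d (unit_matrix d) P"
    using assms by (simp add: mmul_unit_left mmul_unit_right)
  finally show ?case by (simp only: funpow_Suc_right o_apply)
qed (simp add: mpow_0)

lemma mmul_mpow:
  "mmul d (mpow d P n) Q = (mmul d P ^^ n) (mmul d (unit_matrix d) Q)"
  by (induction n) (simp_all add: mpow_Suc mpow_0 mmul_assoc)

lemma mpow_commute: "P \<in> matrices d \<Longrightarrow> mmul d (mpow d P n) P = mpow d P (Suc n)"
  by (simp add: mpow_eq_right)

text \<open>Both sides are the trace of \<open>P\<close> to the power \<open>a + b\<close>, so
  exponents can be moved between the two arguments.\<close>

lemma hs_mpow_add: "symmetric P \<Longrightarrow> hs d (mpow d P a) (mpow d P b) = hs d (unit_matrix d) (mpow d P (a + b))"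
  by (simp add: mpow_def hs.self_adjoint_funpow[OF self_adjoint_mmul_left] funpow_add)

lemma funpow_mmul_eq:
  assumes "P \<in> matrices d" "Q \<in> matrices d"
  shows "(mmul d P ^^ n) Q = mmul d (mpow d P n) Q"
  using assms by (simp add: mmul_mpow mmul_unit_left)

lemma funpow_mvec: "x \<in> eucl d \<Longrightarrow> (mvec d P ^^ n) x = mvec d (mpow d P n) x"
proof (induction n)
  case 0
  have "mvec d (unit_matrix d) x i = (\<Sum>j<d. if j = i then x i else 0)" for i
    unfolding mvec_def ip_def by (intro sum.cong) (auto simp: unit_matrix_def)
  then show ?case
    using 0 by (auto simp: mpow_0 fun_eq_iff topspace_Euclidean_space)
qed (simp add: mpow_Suc mvec_mmul)

text \<open>A trace moment controls the operator norm: \<open>power_form_le\<close> passes to the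
  power \<open>Suc p\<close>, whose operator norm is at most its Hilbert-Schmidt norm, and a root of
  order \<open>Suc p\<close> is taken at the end.\<close>

lemma ip_mvec_power_le:
  assumes "symmetric P" "x \<in> eucl d" and "hs d (mpow d P (Suc p)) (mpow d P (Suc p)) \<le> G ^ Suc p" "0 \<le> G"
  shows "ip d (mvec d P x) (mvec d P x) \<le> G * ip d x x"
proof -
  have "ip d (mvec d P x) (mvec d P x) ^ Suc p \<le>
      ip d x x ^ p * ip d (mvec d (mpow d P (Suc p)) x) (mvec d (mpow d P (Suc p)) x)"
    using ip.power_form_le[OF self_adjoint_mvec[OF assms(1)], where d = d and x = x and p = p] assms(2) funpow_mvec[of x d "Suc p" P]
    by simp
  also have "\<dots> \<le> ip d x x ^ p * (G ^ Suc p * ip d x x)"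
    using ip_mvec_le[of d "mpow d P (Suc p)" x] assms(3) ip.nonneg[of d x]
    by (intro mult_left_mono order_trans[OF ip_mvec_le] mult_right_mono) auto
  also have "\<dots> = (G * ip d x x) ^ Suc p"
    by (simp add: power_mult_distrib)
  finally show ?thesis
    by (rule power_le_imp_le_base) (simp add: assms(4) ip.nonneg)
qed

text \<open>For even exponents, the trace of \<open>P^n Q^2\<close> is the Hilbert-Schmidt form of \<open>P^(n/2) Q\<close>.\<close>

lemma hs_mpow_diff_le:
  assumes P: "symmetric P" "P \<in> matrices d" and Q: "symmetric Q" "Q \<in> matrices d"
  defines "X \<equiv> P - Q"
  shows "hs d X (mpow d P (2 * n + 1) - mpow d Q (2 * n + 1)) \<le>
    (2 * real n + 1) / 2 * (hs d (mmul d (mpow d P n) X) (mmul d (mpow d P n) X)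
      + hs d (mmul d (mpow d Q n) X) (mmul d (mpow d Q n) X))"
proof -
  \<comment> \<open>Associativity makes \<open>L\<close> and \<open>R\<close> commute even if
    \<open>P\<close> and \<open>Q\<close> do not. On the unit matrix they differ by
    \<open>X\<close>, where the telescoping starts.\<close>
  define L where "L = mmul d P"
  define R where "R = (\<lambda>S. mmul d S Q)"
  have L: "hs.self_adjoint d L" and R: "hs.self_adjoint d R" and lin: "linear L" "linear R"
    using P Q by (simp_all add: L_def R_def self_adjoint_mmul_left self_adjoint_mmul_right
        linear_mmul_left linear_mmul_right)
  have comm: "L (R S) = R (L S)" for S by (simp add: L_def R_def mmul_assoc)
  have X: "X \<in> matrices d" "symmetric X" unfolding X_def
    using P Q by (auto simp: matrices_diff symmetric_diff)
  have "L (unit_matrix d) - R (unit_matrix d) = X"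
    using P Q by (simp add: L_def R_def X_def mmul_unit_left mmul_unit_right)
  then have "mpow d P (2 * n + 1) - mpow d Q (2 * n + 1) = (\<Sum>j\<le>2 * n. (L ^^ j) ((R ^^ (2 * n - j)) X))"
    using funpow_diff_telescope[of L R "2 * n" "unit_matrix d", OF lin comm] Q mpow_eq_right[of Q d "2 * n + 1"]
    by (simp add: L_def R_def mpow_def)
  then have "hs d X (mpow d P (2 * n + 1) - mpow d Q (2 * n + 1)) \<le>
      (2 * real n + 1) / 2 * (hs d X ((L ^^ (2 * n)) X) + hs d X ((R ^^ (2 * n)) X))"
    using hs.sum_powers_le[OF L R comm, where x = X and n = n] by (simp add: hs.sum_right)
  also have "hs d X ((L ^^ (2 * n)) X) = hs d (mmul d (mpow d P n) X) (mmul d (mpow d P n) X)"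
  proof -
    have "hs d X ((L ^^ (2 * n)) X) = hs d ((L ^^ n) X) ((L ^^ n) X)"
      by (simp add: hs.self_adjoint_funpow[OF L] mult_2 funpow_add)
    then show ?thesis using P X by (simp add: L_def funpow_mmul_eq)
  qed
  also have "hs d X ((R ^^ (2 * n)) X) = hs d (mmul d (mpow d Q n) X) (mmul d (mpow d Q n) X)"
  proof -
    \<comment> \<open>Transposition fixes the symmetric \<open>X\<close> and \<open>Q\<close>, so it
      converts powers of \<open>R\<close> into left multiplications by \<open>Q\<close>.\<close>
    define t :: "(nat \<Rightarrow> nat \<Rightarrow> real) \<Rightarrow> nat \<Rightarrow> nat \<Rightarrow> real" where "t S = (\<lambda>i j. S j i)" for S
    have t: "t X = X" "t Q = Q" using X Q by (auto simp: t_def symmetric_def fun_eq_iff)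
    have "t (R S) = mmul d Q (t S)" for S
      using mmul_transpose[of d Q S] t by (simp add: R_def t_def)
    then have "t ((R ^^ n) X) = (mmul d Q ^^ n) X"
      using t by (induction n) simp_all
    then have "hs d ((R ^^ n) X) ((R ^^ n) X) = hs d ((mmul d Q ^^ n) X) ((mmul d Q ^^ n) X)"
      using hs_transpose[of d "(R ^^ n) X" "(R ^^ n) X"] by (simp add: t_def)
    moreover have "hs d X ((R ^^ (2 * n)) X) = hs d ((R ^^ n) X) ((R ^^ n) X)"
      by (simp add: hs.self_adjoint_funpow[OF R] mult_2 funpow_add)
    ultimately show ?thesis using Q X by (simp add: funpow_mmul_eq)
  qed
  finally show ?thesis .
qed

section \<open>Trace moments of a sampled covariance\<close>

text \<open>The bound \<open>covariance_le\<close> ranges over all functions because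
  \<open>hs_mmul_M_le\<close> applies it to the rows of arbitrary matrices.\<close>

locale vector_sampling = sampling I \<alpha> k
  for I :: "'i set" and \<alpha> :: "'i \<Rightarrow> real" and k :: nat +
  fixes d :: nat and u :: "'i \<Rightarrow> nat \<Rightarrow> real" and R \<mu> :: real
  assumes u_in: "l \<in> I \<Longrightarrow> u l \<in> eucl d"
    and norm_le: "l \<in> I \<Longrightarrow> ip d (u l) (u l) \<le> R"
    and covariance_le: "(\<Sum>l\<in>I. \<alpha> l * (ip d (u l) x)\<^sup>2) \<le> \<mu> * ip d x x"
    and R_nonneg: "0 \<le> R" and \<mu>_nonneg: "0 \<le> \<mu>"
begin

abbreviation U :: "'i \<Rightarrow> nat \<Rightarrow> nat \<Rightarrow> real"
  where "U l \<equiv> outer (u l) (u l)"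

definition M :: "nat \<Rightarrow> nat \<Rightarrow> real"
  where "M = (\<Sum>l\<in>I. \<alpha> l *\<^sub>R U l)"

definition Y :: "(nat \<Rightarrow> 'i) \<Rightarrow> nat \<Rightarrow> nat \<Rightarrow> real"
  where "Y s = (\<Sum>i<k. U (s i) - M)"

text \<open>As \<open>Y s\<close> is symmetric, this is the expected trace of \<open>Y s\<close> to
  the power \<open>2 * n\<close>.\<close>

definition moment :: "nat \<Rightarrow> real"
  where "moment n = expect (\<lambda>s. hs d (mpow d (Y s) n) (mpow d (Y s) n))"

lemma M_matrix: "M \<in> matrices d" "symmetric M"
  by (auto simp: M_def intro!: matrices_sum matrices_scale outer_in_matrices u_in symmetric_sum
      symmetric_scale symmetric_outer)

lemma Y_symmetric: "symmetric (Y s)"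
  by (auto simp: Y_def intro!: symmetric_sum symmetric_diff symmetric_outer M_matrix)

lemma Y_matrix: "s \<in> seqs \<Longrightarrow> Y s \<in> matrices d"
  by (auto simp: Y_def intro!: matrices_sum matrices_diff outer_in_matrices u_in M_matrix seqs_mem)

lemma Y_upd: "i < k \<Longrightarrow> Y s - Y (s(i := l)) = U (s i) - U l"
  by (simp add: Y_def sum.remove[of "{..<k}" i])

lemma hs_mmul_M: "hs d P (mmul d P M) = (\<Sum>l\<in>I. \<alpha> l * ip d (mvec d P (u l)) (mvec d P (u l)))"
  by (simp add: M_def linear_sum[OF linear_mmul_left] linear_scale[OF linear_mmul_left]
      hs.sum_right hs.scale_right hs_mmul_outer)

lemma hs_mmul_M_le: "hs d P (mmul d P M) \<le> \<mu> * hs d P P"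
proof (rule hs_mmul_le[OF _ M_matrix(2)])
  fix x
  have "ip d x (mvec d M x) = (\<Sum>l\<in>I. \<alpha> l * (ip d (u l) x)\<^sup>2)"
    by (simp add: M_def mvec_sum mvec_scale mvec_outer ip.sum_right ip.scale_right ip.symm[of d x]
        power2_eq_square mult.assoc)
  then show "ip d x (mvec d M x) \<le> \<mu> * ip d x x" using covariance_le by simp
qed

text \<open>The square of \<open>U l\<close> is \<open>U l\<close> times the squared length of
  \<open>u l\<close>, which \<open>R\<close> absorbs; splitting the difference costs the factor
  2.\<close>

lemma hs_mmul_U_diff_le:
  assumes "a \<in> I" "b \<in> I"
  shows "hs d (mmul d P (U a - U b)) (mmul d P (U a - U b)) \<le>
    2 * R * (ip d (mvec d P (u a)) (mvec d P (u a)) + ip d (mvec d P (u b)) (mvec d P (u b)))"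
proof -
  have one: "hs d (mmul d P (U l)) (mmul d P (U l)) \<le> R * ip d (mvec d P (u l)) (mvec d P (u l))"
    if "l \<in> I" for l
    using mult_left_mono[OF norm_le[OF that] ip.nonneg[of d "mvec d P (u l)"]]
    by (simp add: mmul_outer hs_outer mult.commute)
  have "hs d (mmul d P (U a - U b)) (mmul d P (U a - U b)) \<le>
      2 * hs d (mmul d P (U a)) (mmul d P (U a)) + 2 * hs d (mmul d P (U b)) (mmul d P (U b))"
    unfolding linear_diff[OF linear_mmul_left] by (rule hs.diff_diff_le)
  then show ?thesis using one[OF assms(1)] one[OF assms(2)] by (simp add: distrib_left)
qed

text \<open>Resampling coordinate \<open>i\<close> turns the centred factor into an increment of
  \<open>Y\<close>. Then \<open>hs_mpow_diff_le\<close> bounds the increment of the odd power by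
  squares, and averaging over the fresh draw produces \<open>M\<close>.\<close>

lemma moment_coordinate_le:
  fixes n :: nat
  assumes i: "i < k"
  shows "expect (\<lambda>s. hs d (U (s i) - M) (mpow d (Y s) (2 * n + 1))) \<le>
    (2 * real n + 1) * R * expect (\<lambda>s. ip d (mvec d (mpow d (Y s) n) (u (s i))) (mvec d (mpow d (Y s) n) (u (s i)))
      + hs d (mpow d (Y s) n) (mmul d (mpow d (Y s) n) M))"
proof -
  define Z where "Z s = mpow d (Y s) n" for s
  define A where "A s l = hs d (mmul d (Z s) (U (s i) - U l)) (mmul d (Z s) (U (s i) - U l))" for s l
  have upd: "s(i := l) \<in> seqs" if "s \<in> seqs" "l \<in> I" for s l
    using that i by (auto simp: seqs_def PiE_iff extensional_def)
  have "(\<Sum>l\<in>I. \<alpha> l *\<^sub>R (U l - M)) = M - (\<Sum>l\<in>I. \<alpha> l) *\<^sub>R M"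
    by (simp add: M_def scaleR_diff_right sum_subtractf flip: scaleR_sum_left)
  then have centered: "(\<Sum>l\<in>I. \<alpha> l *\<^sub>R (U l - M)) = 0" by (simp add: weight_sum)
  have "2 * expect (\<lambda>s. hs d (U (s i) - M) (mpow d (Y s) (2 * n + 1))) =
      expect (\<lambda>s. \<Sum>l\<in>I. \<alpha> l * hs d (Y s - Y (s(i := l)))
        (mpow d (Y s) (2 * n + 1) - mpow d (Y (s(i := l))) (2 * n + 1)))"
    unfolding Y_upd[OF i]
    using expect_centered_coordinate[OF psd_form_hs i centered, of d "\<lambda>s. mpow d (Y s) (2 * n + 1)"]
    by simp
  also have "\<dots> \<le> expect (\<lambda>s. \<Sum>l\<in>I. \<alpha> l * ((2 * real n + 1) / 2 * (A s l + A (s(i := l)) (s i))))"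
  proof (intro expect_mono sum_mono mult_left_mono weight_nonneg)
    fix s l assume sl: "s \<in> seqs" "l \<in> I"
    \<comment> \<open>The sign drops out of the quadratic form, so the second term is the first one
      for the exchanged pair; \<open>expect_exchange\<close> later gives both the same mean.\<close>
    have "mmul d (Z (s(i := l))) (U (s i) - U l) = - mmul d (Z (s(i := l))) (U l - U (s i))"
      by (simp add: linear_diff[OF linear_mmul_left])
    then have "hs d (mmul d (Z (s(i := l))) (U (s i) - U l)) (mmul d (Z (s(i := l))) (U (s i) - U l)) =
        A (s(i := l)) (s i)"
      using hs.scale_left[of d "-1"] hs.scale_right[of d _ "-1"] by (simp add: A_def)
    then show "hs d (Y s - Y (s(i := l))) (mpow d (Y s) (2 * n + 1) - mpow d (Y (s(i := l))) (2 * n + 1))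
        \<le> (2 * real n + 1) / 2 * (A s l + A (s(i := l)) (s i))"
      using hs_mpow_diff_le[OF Y_symmetric Y_matrix[OF sl(1)] Y_symmetric Y_matrix[OF upd[OF sl]], of n] i
      by (simp add: Y_upd A_def Z_def)
  qed
  also have "\<dots> = (2 * real n + 1) / 2 * (expect (\<lambda>s. \<Sum>l\<in>I. \<alpha> l * A s l)
      + expect (\<lambda>s. \<Sum>l\<in>I. \<alpha> l * A (s(i := l)) (s i)))"
    unfolding expect_add[symmetric] sum.distrib[symmetric] distrib_left[symmetric]
      expect_cmult[symmetric] sum_distrib_left by (simp only: mult.left_commute)
  also have "\<dots> = (2 * real n + 1) * expect (\<lambda>s. \<Sum>l\<in>I. \<alpha> l * A s l)"
    by (simp flip: expect_exchange[OF i])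
  also have "\<dots> \<le> (2 * real n + 1) * expect (\<lambda>s. \<Sum>l\<in>I. \<alpha> l *
      (2 * R * (ip d (mvec d (Z s) (u (s i))) (mvec d (Z s) (u (s i))) +
        ip d (mvec d (Z s) (u l)) (mvec d (Z s) (u l)))))"
    unfolding A_def
    by (intro mult_left_mono[OF expect_mono] sum_mono mult_left_mono weight_nonneg hs_mmul_U_diff_le)
      (auto intro: seqs_mem[OF _ i])
  also have "\<dots> = (2 * real n + 1) * expect (\<lambda>s. 2 * R *
      (ip d (mvec d (Z s) (u (s i))) (mvec d (Z s) (u (s i))) + hs d (Z s) (mmul d (Z s) M)))"
  proof -
    have "(\<Sum>l\<in>I. \<alpha> l * (2 * R * (c + f l))) = 2 * R * (c + (\<Sum>l\<in>I. \<alpha> l * f l))" for c and f :: "'i \<Rightarrow> real"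
    proof -
      have "(\<Sum>l\<in>I. \<alpha> l * (2 * R * (c + f l))) = 2 * R * ((\<Sum>l\<in>I. \<alpha> l) * c + (\<Sum>l\<in>I. \<alpha> l * f l))"
        by (simp add: sum_distrib_left sum_distrib_right sum.distrib distrib_left mult_ac)
      then show ?thesis by (simp add: weight_sum)
    qed
    then show ?thesis by (simp add: hs_mmul_M)
  qed
  finally show ?thesis by (simp add: expect_cmult Z_def)
qed

text \<open>One factor \<open>Y s\<close> is expanded into its \<open>k\<close> terms, each bounded
  by \<open>moment_coordinate_le\<close>. Of the result, the part with \<open>Y s\<close> is split
  between the two moments and the part with \<open>M\<close> is bounded through
  \<open>\<mu>\<close>.\<close>

lemma moment_step:
  fixes n :: nat
  defines "\<beta> \<equiv> (2 * real n + 1) * R"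
  shows "moment (Suc n) \<le> (\<beta>\<^sup>2 + 4 * real k * \<mu> * \<beta>) * moment n"
proof -
  define Z where "Z s = mpow d (Y s) n" for s
  have \<beta>: "0 \<le> \<beta>" by (simp add: \<beta>_def R_nonneg)
  have "moment (Suc n) = expect (\<lambda>s. \<Sum>i<k. hs d (U (s i) - M) (mpow d (Y s) (2 * n + 1)))"
    unfolding moment_def
  proof (rule expect_cong)
    fix s assume s: "s \<in> seqs"
    have "hs d (mpow d (Y s) (Suc n)) (mpow d (Y s) (Suc n)) = hs d (mpow d (Y s) 1) (mpow d (Y s) (2 * n + 1))"
      unfolding hs_mpow_add[OF Y_symmetric] by (simp add: mult_2)
    also have "\<dots> = hs d (Y s) (mpow d (Y s) (2 * n + 1))"
      using mpow_1[OF Y_matrix[OF s]] by simp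
    also have "\<dots> = (\<Sum>i<k. hs d (U (s i) - M) (mpow d (Y s) (2 * n + 1)))"
      by (subst Y_def) (simp only: hs.sum_left)
    finally show "hs d (mpow d (Y s) (Suc n)) (mpow d (Y s) (Suc n)) =
        (\<Sum>i<k. hs d (U (s i) - M) (mpow d (Y s) (2 * n + 1)))" .
  qed
  also have "\<dots> \<le> \<beta> * expect (\<lambda>s. \<Sum>i<k. ip d (mvec d (Z s) (u (s i))) (mvec d (Z s) (u (s i)))
      + hs d (Z s) (mmul d (Z s) M))"
    unfolding expect_sum sum_distrib_left \<beta>_def Z_def
    by (intro sum_mono moment_coordinate_le) simp
  \<comment> \<open>The \<open>U (s i)\<close> add up to \<open>Y s\<close> plus \<open>k\<close>
    copies of \<open>M\<close>; the other \<open>k\<close> copies come from the fresh draws.\<close>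
  also have "\<dots> = expect (\<lambda>s. \<beta> * (hs d (Z s) (mmul d (Z s) (Y s)) + 2 * real k * hs d (Z s) (mmul d (Z s) M)))"
  proof -
    have "(\<Sum>i<k. ip d (mvec d P (u (s i))) (mvec d P (u (s i))) + hs d P (mmul d P M)) =
        hs d P (mmul d P (Y s)) + 2 * real k * hs d P (mmul d P M)" for P s
      by (simp add: Y_def linear_sum[OF linear_mmul_left] linear_diff[OF linear_mmul_left] hs.sum_right
          hs.diff_right hs_mmul_outer sum.distrib sum_subtractf sum_constant_scaleR hs.scale_right
          linear_scale[OF linear_mmul_left] del: sum_constant)
    then show ?thesis by (simp add: expect_cmult)
  qed
  also have "\<dots> \<le> expect (\<lambda>s. hs d (mpow d (Y s) (Suc n)) (mpow d (Y s) (Suc n)) / 2 +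
      (\<beta>\<^sup>2 / 2 + 2 * real k * \<mu> * \<beta>) * hs d (Z s) (Z s))"
  proof (rule expect_mono)
    fix s assume s: "s \<in> seqs"
    have "mmul d (Z s) (Y s) = mpow d (Y s) (Suc n)"
      unfolding Z_def by (rule mpow_commute[OF Y_matrix[OF s]])
    \<comment> \<open>Putting the weight \<open>\<beta>\<close> on \<open>Z s\<close> leaves exactly
      half of the next moment on the right, to be absorbed into the left side at the end.\<close>
    moreover have "2 * hs d (\<beta> *\<^sub>R Z s) (mmul d (Z s) (Y s)) \<le> hs d (\<beta> *\<^sub>R Z s) (\<beta> *\<^sub>R Z s)
        + hs d (mmul d (Z s) (Y s)) (mmul d (Z s) (Y s))"
      by (rule hs.twice_le)
    ultimately have "\<beta> * hs d (Z s) (mmul d (Z s) (Y s)) \<le>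
        \<beta>\<^sup>2 / 2 * hs d (Z s) (Z s) + hs d (mpow d (Y s) (Suc n)) (mpow d (Y s) (Suc n)) / 2"
      by (simp add: hs.expand power2_eq_square)
    moreover have "\<beta> * (2 * real k) * hs d (Z s) (mmul d (Z s) M) \<le> \<beta> * (2 * real k) * (\<mu> * hs d (Z s) (Z s))"
      by (intro mult_left_mono hs_mmul_M_le) (simp add: \<beta>)
    ultimately show "\<beta> * (hs d (Z s) (mmul d (Z s) (Y s)) + 2 * real k * hs d (Z s) (mmul d (Z s) M)) \<le>
        hs d (mpow d (Y s) (Suc n)) (mpow d (Y s) (Suc n)) / 2 +
        (\<beta>\<^sup>2 / 2 + 2 * real k * \<mu> * \<beta>) * hs d (Z s) (Z s)"
      by (simp add: algebra_simps)
  qed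
  also have "\<dots> = moment (Suc n) / 2 + (\<beta>\<^sup>2 / 2 + 2 * real k * \<mu> * \<beta>) * moment n"
    using expect_cmult[of "1/2"] by (simp add: expect_add expect_cmult moment_def Z_def)
  finally show ?thesis by (simp add: algebra_simps)
qed

text \<open>Iterates \<open>moment_step\<close> from the trace \<open>d\<close> of the identity. For
  \<open>n < p\<close> one has \<open>2 * n + 1 \<le> 2 * p\<close>, which gives one common factor
  for all steps.\<close>

lemma moment_le:
  "moment p \<le> ((2 * real p * R)\<^sup>2 + 8 * real p * R * real k * \<mu>) ^ p * real d"
proof -
  let ?b = "(2 * real p * R)\<^sup>2 + 8 * real p * R * real k * \<mu>"
  have "moment n \<le> ?b ^ n * real d" if "n \<le> p" for n
    using that
  proof (induction n)
    case 0
    then show ?case by (simp add: moment_def mpow_0 hs_unit expect_const)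
  next
    case (Suc n)
    let ?\<beta> = "(2 * real n + 1) * R"
    have \<beta>: "0 \<le> ?\<beta>" "?\<beta> \<le> 2 * real p * R"
      using Suc.prems R_nonneg by (auto intro!: mult_right_mono)
    have "moment (Suc n) \<le> (?\<beta>\<^sup>2 + 4 * real k * \<mu> * ?\<beta>) * moment n" by (rule moment_step)
    also have "\<dots> \<le> ?b * moment n"
    proof (rule mult_right_mono)
      have "?\<beta>\<^sup>2 \<le> (2 * real p * R)\<^sup>2" using \<beta> by (intro power_mono)
      moreover have "4 * real k * \<mu> * ?\<beta> \<le> 4 * real k * \<mu> * (2 * real p * R)"
        using \<beta> \<mu>_nonneg by (intro mult_left_mono) auto
      ultimately show "?\<beta>\<^sup>2 + 4 * real k * \<mu> * ?\<beta> \<le> ?b" by (simp add: mult_ac)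
      show "0 \<le> moment n"
        unfolding moment_def using expect_mono[of "\<lambda>_. 0"] by (simp add: expect_const hs.nonneg)
    qed
    also have "\<dots> \<le> ?b * (?b ^ n * real d)"
      using Suc R_nonneg \<mu>_nonneg by (intro mult_left_mono) auto
    finally show ?case by simp
  qed
  then show ?thesis by simp
qed

end

section \<open>Sampling a decomposition of the identity\<close>

lemma enorm_eq_sqrt: "enorm d x = sqrt (ip d x x)"
  by (simp add: enorm_def L2_set_def ip_def power2_eq_square)

lemma enorm_power2: "(enorm d x)\<^sup>2 = ip d x x"
  by (simp add: enorm_eq_sqrt ip.nonneg)

lemma enorm_nonneg: "0 \<le> enorm d x"
  by (simp add: enorm_def)

lemma enorm_add_le: "enorm d (x + y) \<le> enorm d x + enorm d y"
  using L2_set_triangle_ineq[of x y "{..<d}"] by (simp add: enorm_def plus_fun_def)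

lemma enorm_scaleR: "enorm d (r *\<^sub>R x) = \<bar>r\<bar> * enorm d x"
  by (simp add: enorm_eq_sqrt ip.expand real_sqrt_mult flip: mult.assoc)

lemma enorm_le_iff: "0 \<le> r \<Longrightarrow> enorm d x \<le> r \<longleftrightarrow> ip d x x \<le> r\<^sup>2"
  using enorm_nonneg[of d x] by (simp add: power_mono_iff flip: enorm_power2)

lemma abs_ip_le: "\<bar>ip d x y\<bar> \<le> enorm d x * enorm d y"
  unfolding enorm_eq_sqrt real_sqrt_mult[symmetric]
  by (rule real_le_rsqrt) (simp add: ip.Cauchy_Schwarz)

lemma eucl_diff: "x \<in> eucl d \<Longrightarrow> y \<in> eucl d \<Longrightarrow> x - y \<in> eucl d"
  by (simp add: topspace_Euclidean_space)

lemma closedin_enorm_le: "closedin (Euclidean_space d) {x \<in> eucl d. enorm d x \<le> r}"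
proof -
  have "continuous_map (Euclidean_space d) euclidean (\<lambda>x. enorm d x)"
    unfolding continuous_map_Euclidean_space_iff enorm_def L2_set_def
    by (intro continuous_intros continuous_on_product_coordinates continuous_on_subset[OF continuous_on_product_coordinates]) auto
  then have "closedin (Euclidean_space d) {x \<in> eucl d. enorm d x \<in> {..r}}"
    by (rule closedin_continuous_map_preimage) simp
  then show ?thesis by simp
qed

text \<open>Frontier points lie in the closure, and the ball of radius \<open>r\<close> is
  closed.\<close>

lemma bd_enorm_le:
  assumes "K \<subseteq> {x \<in> eucl d. enorm d x \<le> r}" "x \<in> bd d K"
  shows "x \<in> eucl d" "enorm d x \<le> r"
  using closure_of_minimal[OF assms(1) closedin_enorm_le] assms(2) by (auto simp: frontier_of_def)

text \<open>A nonzero \<open>x\<close> is tested against the unit vector in its own direction, which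
  lies in \<open>K\<close>.\<close>

lemma polar_body_subset:
  assumes "unit_ball d \<subseteq> K" shows "polar_body d K \<subseteq> unit_ball d"
proof
  fix x assume x: "x \<in> polar_body d K"
  then have E: "x \<in> eucl d" by (simp add: polar_body_def)
  define n where "n = enorm d x"
  have "n \<le> 1"
  proof (cases "n = 0")
    case False
    then have pos: "0 < n" using enorm_nonneg[of d x] by (simp add: n_def)
    have "(1 / n) *\<^sub>R x \<in> unit_ball d"
      using E pos by (simp add: unit_ball_def enorm_scaleR topspace_Euclidean_space flip: n_def)
    then have "ip d x ((1 / n) *\<^sub>R x) \<le> 1" using x assms by (auto simp: polar_body_def)
    then show ?thesis using pos by (simp add: ip.expand n_def power2_eq_square flip: enorm_power2)
  qed simp
  then show "x \<in> unit_ball d" using E by (simp add: unit_ball_def n_def)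
qed

lemma op_norm_le:
  assumes "0 \<le> \<epsilon>" and "\<And>x. x \<in> eucl d \<Longrightarrow> enorm d (T x) \<le> \<epsilon> * enorm d x"
  shows "op_norm d T \<le> \<epsilon>"
  unfolding op_norm_def
proof (rule cSUP_least)
  show "eucl d \<noteq> {}" by (auto simp: topspace_Euclidean_space intro: exI[of _ 0])
  fix x assume "x \<in> eucl d"
  \<comment> \<open>Where \<open>enorm d x = 0\<close> the quotient is 0 by convention, and
    \<open>0 \<le> \<epsilon>\<close> covers it.\<close>
  then show "enorm d (T x) / enorm d x \<le> \<epsilon>"
    using assms enorm_nonneg[of d x] by (cases "enorm d x = 0") (simp_all add: divide_le_eq)
qed

text \<open>With \<open>w = v - u\<close> of length \<open>O(1/d)\<close>, the operators \<open>u \<otimes> w\<close> are small enough for a plain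
  second-moment bound, which leaves the positive semidefinite operators \<open>u \<otimes> u\<close> for the bound on
  high trace moments. Markov's inequality is applied to the sum of all four normalized quantities.\<close>

lemma sampled_decomposition:
  fixes \<alpha> :: "'i \<Rightarrow> real" and u v :: "'i \<Rightarrow> nat \<Rightarrow> real"
  assumes d: "2 \<le> d" and I: "finite I" "\<And>l. l \<in> I \<Longrightarrow> 0 \<le> \<alpha> l" "(\<Sum>l\<in>I. \<alpha> l) = 1"
    and u: "\<And>l. l \<in> I \<Longrightarrow> u l \<in> eucl d" "\<And>l. l \<in> I \<Longrightarrow> enorm d (u l) \<le> 5 / 4"
    and v: "\<And>l. l \<in> I \<Longrightarrow> v l \<in> eucl d" "\<And>l. l \<in> I \<Longrightarrow> enorm d (v l) \<le> 1"
    and vu: "\<And>l. l \<in> I \<Longrightarrow> enorm d (v l - u l) \<le> 3 / (2 * real d)"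
    and identity: "\<And>x. x \<in> eucl d \<Longrightarrow> (1 / real d) *\<^sub>R x = (\<Sum>l\<in>I. \<alpha> l *\<^sub>R tensor d (u l) (v l) x)"
    and centered: "(\<Sum>l\<in>I. \<alpha> l *\<^sub>R u l) = 0" "(\<Sum>l\<in>I. \<alpha> l *\<^sub>R v l) = 0"
    and k: "0 < k" "10000 * (real d * ln (real d)) \<le> real k * \<epsilon>\<^sup>2" and \<epsilon>: "0 < \<epsilon>" "\<epsilon> < 1"
  obtains s where "s \<in> {..<k} \<rightarrow> I"
    and "\<And>x. x \<in> eucl d \<Longrightarrow>
      enorm d ((real d / real k) *\<^sub>R (\<Sum>i<k. tensor d (u (s i)) (v (s i)) x) - x) \<le> \<epsilon> * enorm d x"
    and "enorm d (\<Sum>i<k. u (s i)) \<le> real k * (\<epsilon> / sqrt (real d))"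
    and "enorm d (\<Sum>i<k. v (s i)) \<le> real k * (\<epsilon> / sqrt (real d))"
proof -
  define w where "w l = v l - u l" for l
  have w: "w l \<in> eucl d" "enorm d (w l) \<le> 3 / (2 * real d)" if "l \<in> I" for l
    using that u v vu by (auto simp: w_def eucl_diff)
  have d0: "0 < real d" using d by simp
  have v_eq: "v l = u l + w l" for l by (simp add: w_def)

  \<comment> \<open>The decomposition of the identity contributes \<open>1 / d\<close>; replacing
    \<open>v\<close> by \<open>u\<close> costs at most \<open>15 / 8 / d\<close>, rounded up to
    \<open>2 / d\<close>.\<close>
  have covariance: "(\<Sum>l\<in>I. \<alpha> l * (ip d (u l) x)\<^sup>2) \<le> 3 / real d * ip d x x" for x
  proof -
    \<comment> \<open>The decomposition is available on \<open>eucl d\<close> only; truncating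
      \<open>x\<close> changes none of the inner products.\<close>
    define y :: "nat \<Rightarrow> real" where "y = (\<lambda>i. if i < d then x i else 0)"
    have y: "y \<in> eucl d" "ip d (u l) x = ip d (u l) y" "ip d x x = ip d y y" for l
      by (auto simp: y_def topspace_Euclidean_space ip_def)
    have "(\<Sum>l\<in>I. \<alpha> l * (ip d (u l) y * ip d (v l) y)) = ip d ((1 / real d) *\<^sub>R y) y"
      unfolding identity[OF y(1)] by (simp add: ip.sum_left ip.expand tensor_def mult.assoc)
    also have "\<dots> = ip d y y / real d" by (simp add: ip.expand)
    finally have main: "(\<Sum>l\<in>I. \<alpha> l * (ip d (u l) y * ip d (v l) y)) = ip d y y / real d" .
    have rest: "\<bar>ip d (u l) y * ip d (w l) y\<bar> \<le> 2 / real d * ip d y y" if l: "l \<in> I" for l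
    proof -
      have "\<bar>ip d (u l) y\<bar> \<le> 5 / 4 * enorm d y"
        using abs_ip_le[of d "u l" y] mult_right_mono[OF u(2)[OF l] enorm_nonneg[of d y]] by linarith
      moreover have "\<bar>ip d (w l) y\<bar> \<le> 3 / (2 * real d) * enorm d y"
        using abs_ip_le[of d "w l" y] mult_right_mono[OF w(2)[OF l] enorm_nonneg[of d y]] by linarith
      ultimately have "\<bar>ip d (u l) y\<bar> * \<bar>ip d (w l) y\<bar> \<le> 5 / 4 * enorm d y * (3 / (2 * real d) * enorm d y)"
        by (intro mult_mono) (auto simp: enorm_nonneg)
      also have "\<dots> = 15 / 8 / real d * ip d y y"
        by (simp add: power2_eq_square flip: enorm_power2)
      also have "\<dots> \<le> 2 / real d * ip d y y"
        by (intro mult_right_mono divide_right_mono) (auto simp: ip.nonneg)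
      finally show ?thesis by (simp add: abs_mult)
    qed
    have "(\<Sum>l\<in>I. \<alpha> l * (ip d (u l) y)\<^sup>2) =
        (\<Sum>l\<in>I. \<alpha> l * (ip d (u l) y * ip d (v l) y)) - (\<Sum>l\<in>I. \<alpha> l * (ip d (u l) y * ip d (w l) y))"
      by (simp add: w_def ip.expand power2_eq_square algebra_simps flip: sum_subtractf)
    also have "\<dots> \<le> ip d y y / real d + (\<Sum>l\<in>I. \<alpha> l * (2 / real d * ip d y y))"
    proof -
      have "(\<Sum>l\<in>I. \<alpha> l * (- (2 / real d * ip d y y))) \<le> (\<Sum>l\<in>I. \<alpha> l * (ip d (u l) y * ip d (w l) y))"
      proof (intro sum_mono mult_left_mono I(2))
        fix l assume "l \<in> I"
        from rest[OF this] show "- (2 / real d * ip d y y) \<le> ip d (u l) y * ip d (w l) y" by linarith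
      qed
      then show ?thesis by (simp add: main sum_negf)
    qed
    also have "\<dots> = 3 / real d * ip d y y" by (simp only: sum_distrib_right[symmetric] I(3)) simp
    finally show ?thesis by (simp only: y(2,3))
  qed

  interpret vector_sampling I \<alpha> k d u "25/16" "3 / real d"
  proof
    fix l assume "l \<in> I"
    then show "ip d (u l) (u l) \<le> 25 / 16"
      using u(2)[of l] enorm_le_iff[of "5 / 4" d "u l"] by (simp add: power_divide)
  qed (use I u covariance in auto)

  \<comment> \<open>The trace moment carries a factor \<open>d\<close>, and
    \<open>d \<le> exp p\<close> keeps its root of order \<open>p\<close> below 3. Since
    \<open>ln d \<ge> 2 / 3\<close>, rounding up still gives
    \<open>p \<le> 3 * ln d\<close>.\<close>
  define p where "p = nat \<lceil>ln (real d)\<rceil>"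
  have "ln 2 \<le> ln (real d)" using d by simp
  then have ln_d: "2 / 3 \<le> ln (real d)" using ln2_ge_two_thirds by linarith
  have p: "ln (real d) \<le> real p" "real p \<le> 3 * ln (real d)" "0 < p"
    using ln_d by (simp_all add: p_def) linarith+
  define b where "b = (2 * real p * (25/16))\<^sup>2 + 8 * real p * (25/16) * real k * (3 / real d)"
  have b: "0 < b" unfolding b_def using p k d0 by (intro add_nonneg_pos) auto

  define W where "W l = outer (w l) (u l)" for l
  define MW where "MW = (\<Sum>l\<in>I. \<alpha> l *\<^sub>R W l)"
  define N where "N s = (\<Sum>i<k. W (s i) - MW)" for s :: "nat \<Rightarrow> 'i"
  have "expect (\<lambda>s. hs d (N s) (N s)) \<le> real k * (4 / (real d)\<^sup>2)"
    unfolding N_def MW_def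
  proof (rule expect_sum_deviation_le[OF psd_form_hs])
    fix l assume l: "l \<in> I"
    have "hs d (W l) (W l) = (enorm d (w l))\<^sup>2 * (enorm d (u l))\<^sup>2"
      by (simp add: W_def hs_outer enorm_power2)
    also have "\<dots> \<le> (3 / (2 * real d))\<^sup>2 * (5 / 4)\<^sup>2"
      using l w u by (intro mult_mono power_mono) (auto simp: enorm_nonneg)
    also have "\<dots> \<le> 4 / (real d)\<^sup>2"
      using d0 by (simp add: power2_eq_square field_simps)
    finally show "hs d (W l) (W l) \<le> 4 / (real d)\<^sup>2" .
  qed
  then have EN: "(real d)\<^sup>2 / (4 * real k) * expect (\<lambda>s. hs d (N s) (N s)) \<le> 1"
    using d0 k by (simp add: field_simps)
  have "expect (\<lambda>s. ip d (\<Sum>i<k. u (s i)) (\<Sum>i<k. u (s i))) \<le> real k * 2"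
    using expect_sum_deviation_le[OF psd_form_ip, of d u 2] norm_le by (fastforce simp: centered)
  then have Eu: "1 / (2 * real k) * expect (\<lambda>s. ip d (\<Sum>i<k. u (s i)) (\<Sum>i<k. u (s i))) \<le> 1"
    using k by (simp add: field_simps)
  have "ip d (v l) (v l) \<le> 2" if "l \<in> I" for l
    using v(2)[OF that] by (simp add: enorm_le_iff)
  then have "expect (\<lambda>s. ip d (\<Sum>i<k. v (s i)) (\<Sum>i<k. v (s i))) \<le> real k * 2"
    using expect_sum_deviation_le[OF psd_form_ip, of d v 2] by (simp add: centered)
  then have Ev: "1 / (2 * real k) * expect (\<lambda>s. ip d (\<Sum>i<k. v (s i)) (\<Sum>i<k. v (s i))) \<le> 1"
    using k by (simp add: field_simps)
  have EY: "1 / (b ^ p * real d) * expect (\<lambda>s. hs d (mpow d (Y s) p) (mpow d (Y s) p)) \<le> 1"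
    using moment_le[of p] b d0 by (simp add: moment_def b_def field_simps)

  define F1 where "F1 s = 1 / (b ^ p * real d) * hs d (mpow d (Y s) p) (mpow d (Y s) p)" for s
  define F2 where "F2 s = (real d)\<^sup>2 / (4 * real k) * hs d (N s) (N s)" for s
  define F3 where "F3 s = 1 / (2 * real k) * ip d (\<Sum>i<k. u (s i)) (\<Sum>i<k. u (s i))" for s
  define F4 where "F4 s = 1 / (2 * real k) * ip d (\<Sum>i<k. v (s i)) (\<Sum>i<k. v (s i))" for s
  have "expect (\<lambda>s. F1 s + F2 s + F3 s + F4 s) \<le> 4"
    using EY EN Eu Ev unfolding F1_def F2_def F3_def F4_def expect_add expect_cmult by linarith
  then obtain s where s: "s \<in> seqs" and F: "F1 s + F2 s + F3 s + F4 s \<le> 4"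
    by (rule expect_attained)
  have "0 \<le> F1 s" "0 \<le> F2 s" "0 \<le> F3 s" "0 \<le> F4 s"
    using b by (auto simp: F1_def F2_def F3_def F4_def hs.nonneg ip.nonneg)
  with F have F4: "F1 s \<le> 4" "F2 s \<le> 4" "F3 s \<le> 4" "F4 s \<le> 4" by auto

  have k\<epsilon>: "6000 * real d \<le> real k * \<epsilon>\<^sup>2"
  proof -
    have "real d * (2 / 3) \<le> real d * ln (real d)" using ln_d by (intro mult_left_mono) auto
    then show ?thesis using k(2) d0 by linarith
  qed
  \<comment> \<open>\<open>F3 s\<close> and \<open>F4 s\<close> being at most 4 means squared norms
    at most \<open>8 * k\<close>, and the sample size gives
    \<open>8 * d \<le> k * \<epsilon>^2\<close>.\<close>
  have sum_le: "enorm d z \<le> real k * (\<epsilon> / sqrt (real d))" if "ip d z z \<le> 8 * real k" for z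
  proof -
    have "8 * real k * real d \<le> real k * (real k * \<epsilon>\<^sup>2)"
      using k\<epsilon> k(1) d0 mult_left_mono[of "8 * real d" "real k * \<epsilon>\<^sup>2" "real k"] by simp
    then have "8 * real k \<le> (real k * (\<epsilon> / sqrt (real d)))\<^sup>2"
      using d0 by (simp add: power_mult_distrib power_divide power2_eq_square field_simps)
    then show ?thesis using that \<epsilon> by (subst enorm_le_iff) auto
  qed

  \<comment> \<open>Half of the error is allotted to \<open>Y s\<close> and half to
    \<open>N s\<close>.\<close>
  have Y_bound: "enorm d (mvec d (Y s) x) \<le> real k * \<epsilon> / (2 * real d) * enorm d x" if x: "x \<in> eucl d" for x
  proof -
    have "hs d (mpow d (Y s) p) (mpow d (Y s) p) \<le> 4 * (b ^ p * real d)"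
      using F4(1) b d0 by (simp add: F1_def field_simps)
    \<comment> \<open>The bound \<open>F1 s \<le> 4\<close> costs \<open>4 \<le> 4 ^ p\<close> and
      the dimension costs \<open>d \<le> 3 ^ p\<close>, so the root of order \<open>p\<close> loses
      only the factor 12.\<close>
    also have "\<dots> \<le> 4 ^ p * (b ^ p * 3 ^ p)"
    proof -
      have "real d \<le> exp (real p)" using p(1) d0 exp_le_cancel_iff[of "ln (real d)" "real p"] by (simp del: exp_le_cancel_iff)
      also have "\<dots> = exp 1 ^ p" by (simp flip: exp_of_nat_mult)
      also have "\<dots> \<le> 3 ^ p" by (intro power_mono exp_le) simp
      finally have "real d \<le> 3 ^ p" .
      moreover have "(4::real) \<le> 4 ^ p" using p(3) power_increasing[of 1 p "4::real"] by simp
      ultimately show ?thesis using b by (intro mult_mono) auto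
    qed
    also have "\<dots> = (12 * b) ^ p"
    proof -
      have "12 * b = 4 * (b * 3)" by simp
      then show ?thesis by (simp only: power_mult_distrib)
    qed
    finally have le: "hs d (mpow d (Y s) p) (mpow d (Y s) p) \<le> (12 * b) ^ p" .
    obtain q where q: "p = Suc q" using p(3) gr0_conv_Suc by blast
    have "ip d (mvec d (Y s) x) (mvec d (Y s) x) \<le> 12 * b * ip d x x"
      using b by (intro ip_mvec_power_le[OF Y_symmetric x le[unfolded q]]) simp
    also have "\<dots> \<le> (real k * \<epsilon> / (2 * real d))\<^sup>2 * ip d x x"
    proof (rule mult_right_mono[OF _ ip.nonneg])
      \<comment> \<open>In terms of \<open>\<delta>\<close>, \<open>b * d^2\<close> combines
        \<open>\<delta> * \<delta>\<close> and \<open>\<delta> * k\<close>. As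
        \<open>\<delta> \<le> k\<close>, 48 times it is at most \<open>2269 * \<delta> * k\<close>,
        within the available 3000; here 48 is 12 times the 4 from the halved error.\<close>
      define \<delta> where "\<delta> = real d * real p"
      have \<delta>: "0 \<le> \<delta>" "3000 * \<delta> \<le> real k * \<epsilon>\<^sup>2"
      proof -
        have "\<delta> \<le> real d * (3 * ln (real d))" unfolding \<delta>_def using p(2) by (intro mult_left_mono) auto
        moreover have "0 \<le> real d * ln (real d)" using ln_d by (intro mult_nonneg_nonneg) auto
        ultimately show "3000 * \<delta> \<le> real k * \<epsilon>\<^sup>2" using k(2) by linarith
      qed (simp add: \<delta>_def)
      have "real k * \<epsilon>\<^sup>2 \<le> real k" using \<epsilon> by (simp add: mult_left_le power_le_one)
      with \<delta> have "\<delta> * \<delta> \<le> \<delta> * real k" by (intro mult_left_mono) auto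
      have "48 * (b * (real d)\<^sup>2) = 48 * (625 / 64 * (\<delta> * \<delta>) + 75 / 2 * (\<delta> * real k))"
        using d0 by (simp add: b_def \<delta>_def power2_eq_square field_simps)
      also have "\<dots> \<le> 3000 * \<delta> * real k"
      proof -
        have "48 * (625 / 64 * a + 75 / 2 * c) \<le> 3000 * c" if "a \<le> c" "0 \<le> c" for a c :: real
          using that by simp
        from this[OF \<open>\<delta> * \<delta> \<le> \<delta> * real k\<close>] \<delta>(1) show ?thesis by (simp only: mult.assoc) simp
      qed
      also have "\<dots> \<le> real k * \<epsilon>\<^sup>2 * real k"
        by (rule mult_right_mono[OF \<delta>(2)]) simp
      finally show "12 * b \<le> (real k * \<epsilon> / (2 * real d))\<^sup>2"
        using d0 by (simp add: power2_eq_square field_simps)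
    qed
    also have "\<dots> = (real k * \<epsilon> / (2 * real d) * enorm d x)\<^sup>2"
      by (simp only: power_mult_distrib enorm_power2)
    finally show ?thesis using \<epsilon> d0 by (subst enorm_le_iff) (auto simp: enorm_nonneg)
  qed

  \<comment> \<open>The Hilbert-Schmidt norm is small enough by itself: its square is at most
    \<open>16 * k / d^2\<close>, and \<open>k * \<epsilon>^2 \<ge> 64\<close> puts this below the
    squared target.\<close>
  have N_bound: "enorm d (mvec d (N s) x) \<le> real k * \<epsilon> / (2 * real d) * enorm d x" for x
  proof -
    have "ip d (mvec d (N s) x) (mvec d (N s) x) \<le> hs d (N s) (N s) * ip d x x" by (rule ip_mvec_le)
    also have "\<dots> \<le> (real k * \<epsilon> / (2 * real d))\<^sup>2 * ip d x x"
    proof (rule mult_right_mono[OF _ ip.nonneg])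
      have "64 * real k \<le> real k * \<epsilon>\<^sup>2 * real k"
        using k\<epsilon> d by (intro mult_right_mono) auto
      moreover have "hs d (N s) (N s) * (real d)\<^sup>2 \<le> 16 * real k"
        using F4(2) k(1) by (simp add: F2_def field_simps)
      ultimately show "hs d (N s) (N s) \<le> (real k * \<epsilon> / (2 * real d))\<^sup>2"
        using d0 by (simp add: power2_eq_square field_simps)
    qed
    also have "\<dots> = (real k * \<epsilon> / (2 * real d) * enorm d x)\<^sup>2"
      by (simp only: power_mult_distrib enorm_power2)
    finally show ?thesis using \<epsilon> d0 by (subst enorm_le_iff) (auto simp: enorm_nonneg)
  qed

  show thesis
  proof (rule that)
    show "s \<in> {..<k} \<rightarrow> I" using s by (auto simp: seqs_def)
    show "enorm d (\<Sum>i<k. u (s i)) \<le> real k * (\<epsilon> / sqrt (real d))"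
      "enorm d (\<Sum>i<k. v (s i)) \<le> real k * (\<epsilon> / sqrt (real d))"
      by (rule sum_le, use F4(3,4) k(1) in \<open>simp add: F3_def F4_def field_simps\<close>)+
    fix x assume x: "x \<in> eucl d"
    have tensor: "tensor d (u l) (v l) x = mvec d (U l) x + mvec d (W l) x" for l
      by (simp add: tensor_def W_def mvec_outer v_eq scaleR_add_right)
    \<comment> \<open>The means of the two parts add up to the identity divided by \<open>d\<close>,
      so after scaling only \<open>Y s\<close> and \<open>N s\<close> contribute to the
      error.\<close>
    have "(1 / real d) *\<^sub>R x = mvec d M x + mvec d MW x"
      unfolding identity[OF x] tensor M_def MW_def
      by (simp add: mvec_sum mvec_scale scaleR_add_right sum.distrib)
    then have "real d *\<^sub>R ((1 / real d) *\<^sub>R x) = real d *\<^sub>R (mvec d M x + mvec d MW x)" by simp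
    then have x_eq: "x = real d *\<^sub>R (mvec d M x + mvec d MW x)" using d0 by simp
    have "(\<Sum>i<k. tensor d (u (s i)) (v (s i)) x) =
        mvec d (Y s) x + mvec d (N s) x + real k *\<^sub>R (mvec d M x + mvec d MW x)"
      unfolding tensor Y_def N_def mvec_sum mvec_diff sum.distrib sum_subtractf sum_constant_scaleR
      by (simp add: scaleR_add_right mvec_scale)
    then have "(real d / real k) *\<^sub>R (\<Sum>i<k. tensor d (u (s i)) (v (s i)) x) - x =
        (real d / real k) *\<^sub>R (mvec d (Y s) x + mvec d (N s) x)"
      using k(1) by (subst (2) x_eq) (simp add: scaleR_add_right)
    then have "enorm d ((real d / real k) *\<^sub>R (\<Sum>i<k. tensor d (u (s i)) (v (s i)) x) - x) \<le>
        real d / real k * (enorm d (mvec d (Y s) x) + enorm d (mvec d (N s) x))"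
      by (simp only: enorm_scaleR abs_of_nonneg divide_nonneg_nonneg of_nat_0_le_iff) (intro mult_left_mono enorm_add_le, simp)
    also have "\<dots> \<le> real d / real k * (real k * \<epsilon> / (2 * real d) * enorm d x + real k * \<epsilon> / (2 * real d) * enorm d x)"
      by (intro mult_left_mono add_mono Y_bound x N_bound) simp
    also have "\<dots> = \<epsilon> * enorm d x" using d0 k(1) by (simp add: field_simps)
    finally show "enorm d ((real d / real k) *\<^sub>R (\<Sum>i<k. tensor d (u (s i)) (v (s i)) x) - x) \<le> \<epsilon> * enorm d x" .
  qed
qed

text \<open>The assumption \<open>2 \<le> d\<close> excludes a false case: for \<open>d = 1\<close>
  the logarithm vanishes, so \<open>k = 1\<close> is allowed, and with
  \<open>K = L = [-1, 1]\<close> a single \<open>u i\<close> has norm 1, which exceeds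
  \<open>\<epsilon>\<close>.\<close>

theorem theorem1p7:
  shows "\<exists>c>0::real. \<forall>(d::nat) K L (m::nat) \<alpha> u v.
    2 \<le> d \<longrightarrow> convex_body d K \<longrightarrow> convex_body d L \<longrightarrow>
    unit_ball d \<subseteq> K \<longrightarrow>
    K \<subseteq> (\<lambda>x. (1 + 1 / (real d)\<^sup>2) *\<^sub>R x) ` unit_ball d \<longrightarrow>
    in_john_position d K L \<longrightarrow>
    john_decomposition d K L m \<alpha> u v \<longrightarrow>
    (\<forall>(\<epsilon>::real) (k::nat).
      0 < \<epsilon> \<longrightarrow> \<epsilon> < 1 \<longrightarrow> 0 < k \<longrightarrow>
      real k \<ge> c * real d * ln (real d) / \<epsilon>\<^sup>2 \<longrightarrow>
      (\<exists>\<sigma>. set_mset \<sigma> \<subseteq> {1..m} \<and> size \<sigma> = k \<and>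
        op_norm d ((real d / real k) *\<^sub>R (\<Sum>i\<in>#\<sigma>. tensor d (u i) (v i)) - id) \<le> \<epsilon> \<and>
        1 / real k * enorm d (\<Sum>i\<in>#\<sigma>. u i) \<le> \<epsilon> / sqrt (real d) \<and>
        1 / real k * enorm d (\<Sum>i\<in>#\<sigma>. v i) \<le> \<epsilon> / sqrt (real d)))"
\<comment> \<open>The constant leaves room for \<open>3000 * \<delta>\<close> with
  \<open>\<delta> \<le> 3 * d * ln d\<close>, its most demanding use in
  \<open>sampled_decomposition\<close>.\<close>
proof (intro exI[of _ 10000] conjI allI impI)
  fix d K L m \<alpha> u v \<epsilon> k
  assume d: "(2::nat) \<le> d" and ball: "unit_ball d \<subseteq> K"
    and K: "K \<subseteq> (\<lambda>x. (1 + 1 / (real d)\<^sup>2) *\<^sub>R x) ` unit_ball d"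
    and john: "john_decomposition d K L m \<alpha> u v"
    and \<epsilon>: "0 < (\<epsilon>::real)" "\<epsilon> < 1" and k: "0 < (k::nat)" "10000 * real d * ln (real d) / \<epsilon>\<^sup>2 \<le> real k"
  define r where "r = 1 + 1 / (real d)\<^sup>2"
  have "4 \<le> (real d)\<^sup>2" using power_mono[of 2 "real d" 2] d by simp
  then have r: "0 < r" "r \<le> 5 / 4" by (auto simp: r_def divide_le_eq intro: add_pos_nonneg)
  have "K \<subseteq> {x \<in> eucl d. enorm d x \<le> r}"
    using K r(1) by (auto simp: unit_ball_def enorm_scaleR topspace_Euclidean_space r_def[symmetric] mult_left_le)
  note K_bd = bd_enorm_le[OF this]
  have "polar_body d K \<subseteq> {x \<in> eucl d. enorm d x \<le> 1}"
    using polar_body_subset[OF ball] by (simp add: unit_ball_def)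
  note polar_bd = bd_enorm_le[OF this]
  have J: "\<And>l. l \<in> {1..m} \<Longrightarrow> 0 \<le> \<alpha> l" "(\<Sum>l=1..m. \<alpha> l) = 1"
    "\<And>x. x \<in> eucl d \<Longrightarrow> (1 / real d) *\<^sub>R x = (\<Sum>l=1..m. \<alpha> l *\<^sub>R tensor d (u l) (v l) x)"
    "(\<Sum>l=1..m. \<alpha> l *\<^sub>R u l) = 0" "(\<Sum>l=1..m. \<alpha> l *\<^sub>R v l) = 0"
    and ubd: "\<And>l. l \<in> {1..m} \<Longrightarrow> u l \<in> bd d K" and vbd: "\<And>l. l \<in> {1..m} \<Longrightarrow> v l \<in> bd d (polar_body d K)"
    and uv: "\<And>l. l \<in> {1..m} \<Longrightarrow> ip d (u l) (v l) = 1"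
    using john by (auto simp: john_decomposition_def sum_fun_apply less_imp_le)
  \<comment> \<open>By \<open>ip d (u l) (v l) = 1\<close> the squared length is at most
    \<open>r^2 + 1 - 2 = (r - 1) * (r + 1)\<close>, where \<open>r - 1 = 1 / d^2\<close> and
    \<open>r + 1 \<le> 9 / 4\<close>. This is where the closeness of \<open>K\<close> to the ball
    enters.\<close>
  have vu: "enorm d (v l - u l) \<le> 3 / (2 * real d)" if l: "l \<in> {1..m}" for l
  proof -
    have "(enorm d (v l))\<^sup>2 \<le> 1"
      by (rule power_le_one[OF enorm_nonneg polar_bd(2)[OF vbd[OF l]]])
    moreover have "(enorm d (u l))\<^sup>2 \<le> r\<^sup>2"
      by (rule power_mono[OF K_bd(2)[OF ubd[OF l]] enorm_nonneg])
    ultimately have "ip d (v l - u l) (v l - u l) \<le> r\<^sup>2 - 1"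
      using uv[OF l] ip.symm[of d "v l" "u l"] by (simp add: ip.diff_diff enorm_power2)
    also have "\<dots> \<le> (3 / (2 * real d))\<^sup>2"
    proof -
      have "r\<^sup>2 - 1 = (r - 1) * (r + 1)" by (simp add: power2_eq_square algebra_simps)
      also have "\<dots> \<le> (r - 1) * (9 / 4)"
        using r(2) by (intro mult_left_mono) (auto simp: r_def)
      finally show ?thesis by (simp add: r_def power2_eq_square)
    qed
    finally show ?thesis by (subst enorm_le_iff) auto
  qed
  have k': "10000 * (real d * ln (real d)) \<le> real k * \<epsilon>\<^sup>2"
    using k(2) \<epsilon>(1) by (simp add: field_simps)
  obtain s where s: "s \<in> {..<k} \<rightarrow> {1..m}"
    and T: "\<And>x. x \<in> eucl d \<Longrightarrow>
      enorm d ((real d / real k) *\<^sub>R (\<Sum>i<k. tensor d (u (s i)) (v (s i)) x) - x) \<le> \<epsilon> * enorm d x"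
    and S: "enorm d (\<Sum>i<k. u (s i)) \<le> real k * (\<epsilon> / sqrt (real d))"
      "enorm d (\<Sum>i<k. v (s i)) \<le> real k * (\<epsilon> / sqrt (real d))"
    using sampled_decomposition[of d "{1..m}" \<alpha> u v k \<epsilon>, OF d _ J(1,2) K_bd(1)[OF ubd]
        order_trans[OF K_bd(2)[OF ubd] r(2)] polar_bd[OF vbd] vu J(3-5) k(1) k' \<epsilon>]
    by auto
  \<comment> \<open>The image multiset keeps repeated draws, so its size is exactly \<open>k\<close>
    and its sums are those over the sequence.\<close>
  define \<sigma> where "\<sigma> = image_mset s (mset_set {..<k})"
  have sum_\<sigma>: "(\<Sum>i\<in>#\<sigma>. f i) = (\<Sum>i<k. f (s i))" for f :: "nat \<Rightarrow> 'c::comm_monoid_add"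
    by (simp add: \<sigma>_def image_mset.compositionality o_def sum_unfold_sum_mset)
  have "op_norm d ((real d / real k) *\<^sub>R (\<Sum>i\<in>#\<sigma>. tensor d (u i) (v i)) - id) \<le> \<epsilon>"
    using T \<epsilon> by (intro op_norm_le) (simp_all add: sum_\<sigma> sum_fun_apply)
  moreover have "set_mset \<sigma> \<subseteq> {1..m}" "size \<sigma> = k"
    using s by (auto simp: \<sigma>_def)
  moreover have "1 / real k * enorm d (\<Sum>i\<in>#\<sigma>. u i) \<le> \<epsilon> / sqrt (real d)"
    "1 / real k * enorm d (\<Sum>i\<in>#\<sigma>. v i) \<le> \<epsilon> / sqrt (real d)"
    unfolding sum_\<sigma> using S k(1) by (simp_all add: divide_le_eq mult.commute)
  ultimately show "\<exists>\<sigma>. set_mset \<sigma> \<subseteq> {1..m} \<and> size \<sigma> = k \<and>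
        op_norm d ((real d / real k) *\<^sub>R (\<Sum>i\<in>#\<sigma>. tensor d (u i) (v i)) - id) \<le> \<epsilon> \<and>
        1 / real k * enorm d (\<Sum>i\<in>#\<sigma>. u i) \<le> \<epsilon> / sqrt (real d) \<and>
        1 / real k * enorm d (\<Sum>i\<in>#\<sigma>. v i) \<le> \<epsilon> / sqrt (real d)"
    by blast
qed simp

end
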